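(* Let $X_1,\dots,X_n$ be Polish spaces, $X=X_1\times\dots\times X_n$, $\mu=(\mu_1,\dots,\mu_n)$ with $\mu_k$ a Borel probability measure on $X_k$, let $W$ be a linear subspace of $C_L(\mu)$ and let $c\in C_L(\mu)$. Then $$\inf_{\pi\in\Pi_W(\mu)}\int_X c\,d\pi=\sup\left\{\sum_{k=1}^n\int_{X_k}f_k\,d\mu_k\ :\ f_k\in C_L(\mu_k)\ (k=1,\dots,n),\ \omega\in W,\ \sum_{k=1}^n f_k(x_k)+\omega(x)\le c(x)\ \text{for all } x=(x_1,\dots,x_n)\in X\right\}.$$
   Context: $\Pi(\mu)$ is the set of Borel probability measures on $X$ whose marginals are $\mu_1,\dots,\mu_n$. $C_L(\mu_i)=L^1(X_i,\mu_i)\cap C(X_i)$ is the space of continuous real-valued $\mu_i$-integrable functions on $X_i$. $C_L(\mu)$ is the space of all continuous $h:X\to\mathbb{R}$ for which there exist $f_i\in C_L(\mu_i)$ ($i=1,\dots,n$) with $|h(x)|\le\sum_{i=1}^n f_i(x_i)$ for all $x=(x_1,\dots,x_n)\in X$. (Every $h\in C_L(\mu)$ is integrable with respect to every $\pi\in\Pi(\mu)$.) For a linear subspace $W\subset C_L(\mu)$, $\Pi_W(\mu)=\{\pi\in\Pi(\mu):\int_X w\,d\pi=0\ \text{for all } w\in W\}$. Convention: $\inf\varnothing=+\infty$ (the set $\Pi_W(\mu)$ may be empty). *)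

theory Defs
  imports "HOL-Analysis.Analysis" "HOL-Probability.Probability" "HOL-Library.Function_Algebras"
begin

text \<open>
  The factors may be different spaces, so each is an abstract \<^typ>\<open>'a topology\<close>
  with its own carrier \<^const>\<open>topspace\<close>; the class \<^class>\<open>polish_space\<close> would force
  all factors to be one and the same type. Any finite family of topological spaces fits into
  one type \<open>'a\<close>, for instance their disjoint union.
\<close>

definition polish_topology :: "'a topology \<Rightarrow> bool" where
  "polish_topology T \<longleftrightarrow> completely_metrizable_space T \<and> separable_space T"

definition borel_of :: "'a topology \<Rightarrow> 'a measure" where
  "borel_of T = sigma (topspace T) {U. openin T U}"

lemma space_borel_of [simp]: "space (borel_of T) = topspace T"
  by (simp add: borel_of_def space_measure_of_conv)

lemma sets_borel_of: "sets (borel_of T) = sigma_sets (topspace T) {U. openin T U}"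
  unfolding borel_of_def by (rule sets_measure_of) (auto dest: openin_subset)

definition borel_prob :: "'a topology \<Rightarrow> 'a measure \<Rightarrow> bool" where
  "borel_prob T M \<longleftrightarrow> prob_space M \<and> sets M = sets (borel_of T)"

text \<open>The points of the product are the functions in \<open>\<Pi>\<^sub>E k\<in>{1..n}. topspace (X k)\<close>.\<close>

abbreviation prod_top :: "nat \<Rightarrow> (nat \<Rightarrow> 'a topology) \<Rightarrow> (nat \<Rightarrow> 'a) topology" where
  "prod_top n X \<equiv> product_topology X {1..n}"

definition couplings ::
  "nat \<Rightarrow> (nat \<Rightarrow> 'a topology) \<Rightarrow> (nat \<Rightarrow> 'a measure) \<Rightarrow> (nat \<Rightarrow> 'a) measure set" where
  "couplings n X \<mu> =
    {\<pi>. borel_prob (prod_top n X) \<pi> \<and>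
        (\<forall>k\<in>{1..n}. distr \<pi> (borel_of (X k)) (\<lambda>x. x k) = \<mu> k)}"

text \<open>
  Real functions on a space are represented by total functions, of which only the values on
  \<^const>\<open>topspace\<close> matter: continuity, integrability, integrals and pointwise bounds below
  all refer to the carrier only.
\<close>

definition CL1 :: "'a topology \<Rightarrow> 'a measure \<Rightarrow> ('a \<Rightarrow> real) set" where
  "CL1 T M = {f. continuous_map T euclideanreal f \<and> integrable M f}"

definition CL ::
  "nat \<Rightarrow> (nat \<Rightarrow> 'a topology) \<Rightarrow> (nat \<Rightarrow> 'a measure) \<Rightarrow> ((nat \<Rightarrow> 'a) \<Rightarrow> real) set" where
  "CL n X \<mu> =
    {h. continuous_map (prod_top n X) euclideanreal h \<and>
        (\<exists>f. (\<forall>k\<in>{1..n}. f k \<in> CL1 (X k) (\<mu> k)) \<and>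
             (\<forall>x\<in>topspace (prod_top n X). \<bar>h x\<bar> \<le> (\<Sum>k=1..n. f k (x k))))}"

text \<open>
  Subspaces for the pointwise operations. This loses no generality with respect to subspaces of
  functions on the carrier, since extension by zero is linear.
\<close>

abbreviation fun_subspace :: "('b \<Rightarrow> real) set \<Rightarrow> bool" where
  "fun_subspace \<equiv> module.subspace (\<lambda>(r::real) (h::'b \<Rightarrow> real) x. r * h x)"

lemma fun_subspace_iff:
  "fun_subspace W \<longleftrightarrow>
    (\<lambda>x. 0) \<in> W \<and> (\<forall>g\<in>W. \<forall>h\<in>W. (\<lambda>x. g x + h x) \<in> W) \<and> (\<forall>r. \<forall>h\<in>W. (\<lambda>x. r * h x) \<in> W)"
proof -
  have "module (\<lambda>(r::real) (h::'b \<Rightarrow> real) x. r * h x)"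
    by unfold_locales (auto simp: fun_eq_iff algebra_simps)
  from module.subspace_def[OF this, of W] show ?thesis
    by (simp add: zero_fun_def plus_fun_def)
qed

definition couplings_on ::
  "nat \<Rightarrow> (nat \<Rightarrow> 'a topology) \<Rightarrow> (nat \<Rightarrow> 'a measure) \<Rightarrow> ((nat \<Rightarrow> 'a) \<Rightarrow> real) set
    \<Rightarrow> (nat \<Rightarrow> 'a) measure set" where
  "couplings_on n X \<mu> W = {\<pi> \<in> couplings n X \<mu>. \<forall>w\<in>W. (\<integral>x. w x \<partial>\<pi>) = 0}"

end

theory Submission
  imports Defs
begin

text \<open>
  Let \<open>p h\<close> be the infimum of \<open>\<Sum>k. \<integral> f k d\<mu> k\<close> over all \<open>f\<close> and \<open>\<omega> \<in> W\<close> with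
  \<open>h \<le> (\<Sum>k. f k (x k)) + \<omega> x\<close>, so that the supremum in question is \<open>- p (- c)\<close>. If \<open>p 0 < 0\<close>, scaling
  makes the supremum infinite, and weak duality makes the infimum infinite as well. Otherwise \<open>p\<close> is
  sublinear and finite, and Hahn-Banach gives a linear \<open>L \<le> p\<close> with equality at \<open>- c\<close>. Such an \<open>L\<close>
  is positive, vanishes on \<open>W\<close> and has the right marginals. Tightness of the marginals forces
  \<open>L (h i)\<close> to tend to \<open>0\<close> whenever \<open>h i\<close> decreases pointwise to \<open>0\<close>, so by Daniell-Stone \<open>L\<close> is integration
  against a measure, which is an optimal coupling.
\<close>

section \<open>Hahn-Banach for sublinear functionals\<close>

text \<open>The factors need not be compact and members of \<open>CL\<close> may be unbounded, so
  countable additivity of \<open>L\<close> cannot be read off its positivity through the Riesz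
  theorem on compact spaces. It comes from the marginals instead: \<open>L\<close> lies below the
  total of every separable majorant, so a sequence decreasing to 0 only needs a late member with a
  separable majorant of small total, and tightness of each \<open>\<mu> k\<close> supplies one. The
  representing measure is built by a Caratheodory extension on
  \<open>\<Omega> \<times> UNIV\<close>. Indicators of subsets of \<open>\<Omega>\<close> need not
  lie in \<open>E\<close>, so \<open>L\<close> gives no direct premeasure on
  \<open>\<Omega>\<close>; sets bounded by two graphs of functions in \<open>E\<close> carry one.
  Hahn-Banach is used to attain \<open>p\<close> at the single point \<open>- c\<close>. The optimal
  coupling is therefore obtained directly as a representing measure, not as a weak limit of nearly
  optimal ones.\<close>

definition sublinear_on :: "(real \<Rightarrow> 'v::ab_group_add \<Rightarrow> 'v) \<Rightarrow> 'v set \<Rightarrow> ('v \<Rightarrow> real) \<Rightarrow> bool" where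
  "sublinear_on scl E q \<longleftrightarrow>
    (\<forall>x\<in>E. \<forall>y\<in>E. q (x + y) \<le> q x + q y) \<and> (\<forall>r\<ge>0. \<forall>x\<in>E. q (scl r x) = r * q x)"

text \<open>Keeps infima of sublinear functionals finite: anything sublinear below \<open>p\<close>
  stays above \<open>- p (- x)\<close> at every \<open>x\<close> of \<open>E\<close>.\<close>

lemma sublinear_on_neg_ge:
  assumes "vector_space scl" "module.subspace scl E" "sublinear_on scl E q" "x \<in> E"
  shows "- q (- x) \<le> q x"
proof -
  interpret vector_space scl by fact
  have "- x \<in> E" using assms by (simp add: subspace_neg)
  then have "q (x + - x) \<le> q x + q (- x)"
    using assms unfolding sublinear_on_def by blast
  moreover have "q (scl 0 x) = 0 * q x"
    using assms unfolding sublinear_on_def by blast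
  ultimately show ?thesis by simp
qed

text \<open>Putting \<open>x = - v\<close> in the last bound gives
  \<open>q' (- v) \<le> - q v\<close>, so \<open>q'\<close> is already linear along
  \<open>v\<close>. The witness is the infimum of \<open>q (x + t v) - t q v\<close> over
  \<open>t \<ge> 0\<close>; the two stated bounds are its terms at \<open>t = 0\<close> and
  \<open>t = 1\<close>.\<close>

lemma sublinear_on_shift:
  fixes scl :: "real \<Rightarrow> 'v::ab_group_add \<Rightarrow> 'v"
  assumes "vector_space scl" and E: "module.subspace scl E"
    and q: "sublinear_on scl E q" and v: "v \<in> E"
  obtains q' where "sublinear_on scl E q'" "\<And>x. x \<in> E \<Longrightarrow> q' x \<le> q x"
    "\<And>x. x \<in> E \<Longrightarrow> q' x \<le> q (x + v) - q v"
proof -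
  interpret vector_space scl by fact
  have add: "q (x + y) \<le> q x + q y" if "x \<in> E" "y \<in> E" for x y
    using q that unfolding sublinear_on_def by blast
  have hom: "q (scl r x) = r * q x" if "r \<ge> 0" "x \<in> E" for r x
    using q that unfolding sublinear_on_def by blast
  define F where "F x t = q (x + scl t v) - t * q v" for x t
  define q' where "q' x = (INF t\<in>{0..}. F x t)" for x
  have inE: "x + scl t v \<in> E" if "x \<in> E" for x t
    using that v E by (simp add: subspace_add subspace_scale)
  have bdd: "bdd_below (F x ` {0..})" if x: "x \<in> E" for x
  proof (rule bdd_belowI2)
    fix t :: real assume t: "t \<in> {0..}"
    have "q (scl t v) \<le> q (x + scl t v) + q (- x)"
      using add[OF inE[OF x, of t], of "- x"] E x by (simp add: subspace_neg)
    then show "- q (- x) \<le> F x t" using hom[of t v] v t by (simp add: F_def)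
  qed
  have le: "q' x \<le> F x t" if "x \<in> E" "t \<ge> 0" for x t
    unfolding q'_def using that by (intro cINF_lower bdd) auto
  have ge: "r \<le> q' x" if "\<And>t. t \<ge> 0 \<Longrightarrow> r \<le> F x t" for x r
    unfolding q'_def using that by (intro cINF_greatest) auto
  have "q' (x + y) \<le> q' x + q' y" if xy: "x \<in> E" "y \<in> E" for x y
  proof -
    have xyE: "x + y \<in> E" using xy E by (simp add: subspace_add)
    \<comment> \<open>A shift by \<open>t\<close> for \<open>x\<close> and one by \<open>s\<close>
      for \<open>y\<close> combine to a shift by \<open>t + s\<close> for \<open>x + y\<close>;
      hence the infimum over all nonnegative \<open>t\<close>, not just over 0 and 1.\<close>
    have *: "q' (x + y) - F y s \<le> F x t" if "t \<ge> 0" "s \<ge> 0" for s t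
    proof -
      have "F (x + y) (t + s) \<le> F x t + F y s"
        using add[OF inE[OF xy(1), of t] inE[OF xy(2), of s]]
        by (simp add: F_def algebra_simps)
      with le[OF xyE, of "t + s"] that show ?thesis by simp
    qed
    have "q' (x + y) - q' x \<le> F y s" if "s \<ge> 0" for s
      using ge[of "q' (x + y) - F y s" x] *[OF _ that] by (simp add: algebra_simps)
    then show ?thesis using ge[of "q' (x + y) - q' x" y] by simp
  qed
  moreover have "q' (scl r x) = r * q' x" if r: "r \<ge> 0" and x: "x \<in> E" for r x
  proof -
    have rx: "scl r x \<in> E" using x E by (simp add: subspace_scale)
    \<comment> \<open>\<open>F\<close> is homogeneous in both arguments together, so scaling
      \<open>x\<close> by a positive factor only reparametrizes the infimum over
      \<open>t\<close>.\<close>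
    have sc: "F (scl a y) (a * t) = a * F y t" if "a \<ge> 0" "y \<in> E" for a t y
      using hom[OF \<open>a \<ge> 0\<close> inE[OF that(2), of t]] by (simp add: F_def algebra_simps)
    show ?thesis
    proof (cases "r = 0")
      case True
      have "F 0 t = 0" if "t \<ge> 0" for t using hom[OF that v] by (simp add: F_def)
      then show ?thesis using True by (simp add: q'_def cong: INF_cong_simp)
    next
      case False
      with r have r: "r > 0" by simp
      have "q' (scl r x) / r \<le> q' x"
      proof (rule ge)
        fix t :: real assume "t \<ge> 0"
        then show "q' (scl r x) / r \<le> F x t"
          using le[OF rx, of "r * t"] sc[of r x t] r x by (simp add: field_simps)
      qed
      moreover have "r * q' x \<le> q' (scl r x)"
      proof (rule ge)
        fix t :: real assume "t \<ge> 0"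
        then have "F (scl r x) t = r * F x (t / r)" "q' x \<le> F x (t / r)"
          using sc[of r x "t / r"] r x le[OF x, of "t / r"] by simp_all
        then show "r * q' x \<le> F (scl r x) t" using r by simp
      qed
      ultimately show ?thesis using r by (simp add: field_simps)
    qed
  qed
  ultimately have "sublinear_on scl E q'"
    by (simp add: sublinear_on_def)
  then show thesis
    by (rule that) (use le[of _ 0] le[of _ 1] in \<open>auto simp: F_def\<close>)
qed

text \<open>Zorn's lemma for the reversed pointwise order: a chain is bounded by its pointwise
  infimum, which is finite by \<open>sublinear_on_neg_ge\<close>.\<close>

lemma minimal_sublinear_exists:
  fixes scl :: "real \<Rightarrow> 'v::ab_group_add \<Rightarrow> 'v"
  assumes vs: "vector_space scl" and E: "module.subspace scl E"
    and p: "sublinear_on scl E p"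
  obtains q where "sublinear_on scl E q" "\<And>x. x \<in> E \<Longrightarrow> q x \<le> p x"
    "\<forall>q'. sublinear_on scl E q' \<longrightarrow> (\<forall>x\<in>E. q' x \<le> q x) \<longrightarrow> (\<forall>x\<in>E. q' x = q x)"
proof -
  interpret vector_space scl by fact
  \<comment> \<open>Values off \<open>E\<close> are fixed to 0, which \<open>cut\<close> achieves:
    the order compares values on \<open>E\<close> only and would otherwise fail to be
    antisymmetric.\<close>
  define S where "S = {q. sublinear_on scl E q \<and> (\<forall>x\<in>E. q x \<le> p x) \<and> (\<forall>x. x \<notin> E \<longrightarrow> q x = 0)}"
  define cut where "cut q = (\<lambda>x. if x \<in> E then q x else 0)" for q :: "'v \<Rightarrow> real"
  have subl_cut: "sublinear_on scl E (cut q) \<longleftrightarrow> sublinear_on scl E q" for q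
    using E by (auto simp: sublinear_on_def cut_def subspace_add subspace_scale)
  \<comment> \<open>\<open>P a b\<close> says that \<open>b\<close> lies below \<open>a\<close>, so
    a maximal element in the sense of Zorn is a minimal functional.\<close>
  define P where "P = (\<lambda>a b. \<forall>x\<in>E. (b x :: real) \<le> a x)"
  have "\<exists>m\<in>S. \<forall>a\<in>S. P m a \<longrightarrow> a = m"
  proof (rule predicate_Zorn)
    show "partial_order_on S (relation_of P S)"
    proof (rule partial_order_on_relation_ofI)
      show "P a a" for a by (simp add: P_def)
      show "P a c" if "P a b" "P b c" for a b c
        using that unfolding P_def by (meson order_trans)
      show "a = b" if "a \<in> S" "b \<in> S" "P a b" "P b a" for a b
        using that by (auto simp: S_def P_def fun_eq_iff) (metis order_antisym)
    qed
  next
    fix C assume C: "C \<in> Chains (relation_of P S)"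
    then have CS: "C \<subseteq> S" by (auto simp: Chains_def relation_of_def)
    have chain: "P a b \<or> P b a" if "a \<in> C" "b \<in> C" for a b
      using C that by (auto simp: Chains_def relation_of_def)
    show "\<exists>u\<in>S. \<forall>a\<in>C. P a u"
    proof (cases "C = {}")
      case True
      have "cut p \<in> S" using p by (auto simp: S_def subl_cut) (auto simp: cut_def)
      with True show ?thesis by blast
    next
      case False
      define u where "u x = (INF q\<in>C. q x)" for x
      have bdd: "bdd_below ((\<lambda>q. q x) ` C)" if x: "x \<in> E" for x
      proof (rule bdd_belowI2)
        fix q assume "q \<in> C"
        then have q: "sublinear_on scl E q" "\<forall>x\<in>E. q x \<le> p x" using CS by (auto simp: S_def)
        have "- x \<in> E" using E x by (simp add: subspace_neg)
        with q(2) sublinear_on_neg_ge[OF vs E q(1) x] show "- p (- x) \<le> q x" by force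
      qed
      have le: "u x \<le> q x" if "x \<in> E" "q \<in> C" for x q
        unfolding u_def using that by (intro cINF_lower bdd)
      have ge: "r \<le> u x" if "\<And>q. q \<in> C \<Longrightarrow> r \<le> q x" for x r
        unfolding u_def using that False by (intro cINF_greatest) auto
      have Cadd: "q (x + y) \<le> q x + q y" if "q \<in> C" "x \<in> E" "y \<in> E" for q x y
        using that CS unfolding S_def sublinear_on_def by blast
      have Chom: "q (scl r x) = r * q x" if "q \<in> C" "x \<in> E" "r \<ge> 0" for q x r
        using that CS unfolding S_def sublinear_on_def by blast
      have "u (x + y) \<le> u x + u y" if xy: "x \<in> E" "y \<in> E" for x y
      proof -
        have xyE: "x + y \<in> E" using xy E by (simp add: subspace_add)
        \<comment> \<open>Subadditivity of the infimum needs one functional serving both points; in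
          a chain the smaller of \<open>q\<close> and \<open>q'\<close> does.\<close>
        have *: "u (x + y) \<le> q x + q' y" if q: "q \<in> C" "q' \<in> C" for q q'
        proof (cases "P q q'")
          case True
          then have "q' x \<le> q x" using xy by (simp add: P_def)
          then show ?thesis using le[OF xyE q(2)] Cadd[OF q(2) xy] by linarith
        next
          case False
          then have "q y \<le> q' y" using xy chain[OF q] by (auto simp: P_def)
          then show ?thesis using le[OF xyE q(1)] Cadd[OF q(1) xy] by linarith
        qed
        have "u (x + y) - u x \<le> q' y" if "q' \<in> C" for q'
          using ge[of "u (x + y) - q' y" x] *[OF _ that] by (simp add: algebra_simps)
        then show ?thesis using ge[of "u (x + y) - u x" y] by simp
      qed
      moreover have "u (scl r x) = r * u x" if r: "r \<ge> 0" and x: "x \<in> E" for r x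
      proof (rule antisym)
        have rx: "scl r x \<in> E" using x E by (simp add: subspace_scale)
        show "r * u x \<le> u (scl r x)"
          by (rule ge) (simp add: Chom[OF _ x r] mult_left_mono[OF le[OF x] r])
        show "u (scl r x) \<le> r * u x"
        proof (cases "r = 0")
          case True
          obtain q where "q \<in> C" using False by blast
          then show ?thesis using le[OF rx \<open>q \<in> C\<close>] Chom[OF \<open>q \<in> C\<close> x r] True by simp
        next
          case r0: False
          have "u (scl r x) / r \<le> u x"
          proof (rule ge)
            fix q assume "q \<in> C"
            then show "u (scl r x) / r \<le> q x"
              using le[OF rx, of q] Chom[OF _ x r] r r0 by (simp add: field_simps)
          qed
          then show ?thesis using r r0 by (simp add: field_simps)
        qed
      qed
      ultimately have "sublinear_on scl E u" by (simp add: sublinear_on_def)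
      moreover have "u x \<le> p x" if x: "x \<in> E" for x
      proof -
        obtain q where "q \<in> C" using False by blast
        then have "q x \<le> p x" using CS x by (auto simp: S_def)
        with le[OF x \<open>q \<in> C\<close>] show ?thesis by linarith
      qed
      ultimately have "cut u \<in> S" by (auto simp: S_def subl_cut) (auto simp: cut_def)
      moreover have "\<forall>a\<in>C. P a (cut u)" using le by (auto simp: P_def cut_def)
      ultimately show ?thesis by blast
    qed
  qed
  then obtain q where q: "q \<in> S" and min: "\<And>a. a \<in> S \<Longrightarrow> P q a \<Longrightarrow> a = q" by blast
  show thesis
  proof
    show "sublinear_on scl E q" "\<And>x. x \<in> E \<Longrightarrow> q x \<le> p x" using q by (auto simp: S_def)
  next
    show "\<forall>q'. sublinear_on scl E q' \<longrightarrow> (\<forall>x\<in>E. q' x \<le> q x) \<longrightarrow> (\<forall>x\<in>E. q' x = q x)"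
    proof (intro allI impI ballI)
      fix q' x
      assume q': "sublinear_on scl E q'" "\<forall>x\<in>E. q' x \<le> q x" and x: "x \<in> E"
      have "\<forall>x\<in>E. q' x \<le> p x" using q' q unfolding S_def by (auto intro: order_trans)
      then have "cut q' \<in> S" using q' by (auto simp: S_def subl_cut) (auto simp: cut_def)
      then have "cut q' = q" using q' by (intro min) (auto simp: P_def cut_def)
      then show "q' x = q x" using x by (metis cut_def)
    qed
  qed
qed

text \<open>A minimal sublinear functional is linear, since its shifts cannot lie below it.\<close>
lemma hahn_banach_dominated:
  fixes scl :: "real \<Rightarrow> 'v::ab_group_add \<Rightarrow> 'v"
  assumes vs: "vector_space scl" and E: "module.subspace scl E"
    and p: "sublinear_on scl E p" and z: "z \<in> E"
  obtains L where "\<And>x y. x \<in> E \<Longrightarrow> y \<in> E \<Longrightarrow> L (x + y) = L x + L y"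
    "\<And>r x. x \<in> E \<Longrightarrow> L (scl r x) = r * L x"
    "\<And>x. x \<in> E \<Longrightarrow> L x \<le> p x" "L z = p z"
proof -
  interpret vector_space scl by fact
  \<comment> \<open>Shifting by \<open>z\<close> before minimizing forces the prescribed value: any
    linear \<open>L\<close> below \<open>p'\<close> has
    \<open>L (- z) \<le> p 0 - p z = - p z\<close>, that is \<open>p z \<le> L z\<close>.\<close>
  obtain p' where p': "sublinear_on scl E p'" "\<And>x. x \<in> E \<Longrightarrow> p' x \<le> p x"
    "\<And>x. x \<in> E \<Longrightarrow> p' x \<le> p (x + z) - p z"
    using sublinear_on_shift[OF vs E p z] by metis
  obtain L where L: "sublinear_on scl E L" "\<And>x. x \<in> E \<Longrightarrow> L x \<le> p' x"
    and min: "\<forall>q'. sublinear_on scl E q' \<longrightarrow> (\<forall>x\<in>E. q' x \<le> L x) \<longrightarrow> (\<forall>x\<in>E. q' x = L x)"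
    by (rule minimal_sublinear_exists[OF vs E p'(1)]) (rule that)
  have add: "L (x + y) = L x + L y" if xy: "x \<in> E" "y \<in> E" for x y
  proof -
    obtain q' where q': "sublinear_on scl E q'" "\<And>x. x \<in> E \<Longrightarrow> q' x \<le> L x"
      "\<And>x. x \<in> E \<Longrightarrow> q' x \<le> L (x + y) - L y"
      using sublinear_on_shift[OF vs E L(1) xy(2)] by metis
    have "q' x = L x" using min q'(1,2) xy(1) by blast
    then have "L x \<le> L (x + y) - L y" using q'(3)[OF xy(1)] by simp
    moreover have "L (x + y) \<le> L x + L y" using L(1) xy unfolding sublinear_on_def by blast
    ultimately show ?thesis by simp
  qed
  have pos: "L (scl r x) = r * L x" if "r \<ge> 0" "x \<in> E" for r x
    using L(1) that unfolding sublinear_on_def by blast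
  have L0: "L 0 = 0" using add[of 0 0] E by (simp add: subspace_0)
  have neg: "L (- x) = - L x" if "x \<in> E" for x
    using add[OF that, of "- x"] that E L0 by (simp add: subspace_neg)
  have p0: "p 0 = 0" using p z unfolding sublinear_on_def by (metis mult_zero_left order_refl scale_zero_left)
  show thesis
  proof
    show "L (scl r x) = r * L x" if x: "x \<in> E" for r x
    proof (cases "r \<ge> 0")
      case False
      then have "L (scl (- r) x) = (- r) * L x" using pos[of "- r"] x by simp
      then show ?thesis using neg[of "scl r x"] x E by (simp add: subspace_scale)
    qed (simp add: pos x)
    have "- z \<in> E" using z E by (simp add: subspace_neg)
    then have "L (- z) \<le> - p z" using L(2)[of "- z"] p'(3)[of "- z"] p0 by simp
    then show "L z = p z" using neg[OF z] L(2)[OF z] p'(2)[OF z] by simp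
  qed (use add L(2) p'(2) in \<open>blast intro: order_trans\<close>)+
qed

section \<open>The Daniell-Stone theorem\<close>

text \<open>The \<open>j\<close>-th summand is the part of \<open>y\<close> between the heights
  \<open>j\<close> and \<open>j + 1\<close>.\<close>

lemma sum_clamp_layers:
  fixes y :: real assumes "0 \<le> y"
  shows "(\<Sum>j<N. max 0 (min 1 (y - real j))) = min y (real N)"
  using assms by (induction N) (auto simp: min_def max_def)

text \<open>Counts the layers that \<open>y\<close> enters, the last one possibly only in part; that
  partial layer is the \<open>+ 1\<close>, which later turns into the error term
  \<open>L 1\<close>.\<close>

lemma sum_layer_indicators_le:
  fixes y :: real assumes "0 \<le> y"
  shows "(\<Sum>j<N. of_bool (real j < y)) \<le> y + 1"
proof -
  have "(\<Sum>j<N. of_bool (real j < y)) \<le> min (real N) (y + 1)"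
    using assms by (induction N) (auto simp: min_def of_bool_def split: if_splits)
  then show ?thesis by simp
qed

text \<open>A vector lattice with constants is closed under truncation at any level, and
  \<open>L 1\<close> will be the finite total mass. Order and convergence are tested on
  \<open>\<Omega>\<close> only, the functions being total; by \<open>L_cong\<close> values off
  \<open>\<Omega>\<close> do not affect \<open>L\<close>.\<close>

locale daniell_functional =
  fixes \<Omega> :: "'b set" and E :: "('b \<Rightarrow> real) set" and L :: "('b \<Rightarrow> real) \<Rightarrow> real"
  assumes E_add: "f \<in> E \<Longrightarrow> g \<in> E \<Longrightarrow> (\<lambda>x. f x + g x) \<in> E"
    and E_scale: "f \<in> E \<Longrightarrow> (\<lambda>x. r * f x) \<in> E"
    and E_one: "(\<lambda>x. 1) \<in> E"
    and E_max: "f \<in> E \<Longrightarrow> g \<in> E \<Longrightarrow> (\<lambda>x. max (f x) (g x)) \<in> E"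
    and L_add: "f \<in> E \<Longrightarrow> g \<in> E \<Longrightarrow> L (\<lambda>x. f x + g x) = L f + L g"
    and L_scale: "f \<in> E \<Longrightarrow> L (\<lambda>x. r * f x) = r * L f"
    and L_nonneg: "f \<in> E \<Longrightarrow> (\<And>x. x \<in> \<Omega> \<Longrightarrow> 0 \<le> f x) \<Longrightarrow> 0 \<le> L f"
    and L_continuous: "(\<And>i::nat. h i \<in> E) \<Longrightarrow> (\<And>i x. x \<in> \<Omega> \<Longrightarrow> h (Suc i) x \<le> h i x) \<Longrightarrow>
      (\<And>x. x \<in> \<Omega> \<Longrightarrow> (\<lambda>i. h i x) \<longlonglongrightarrow> 0) \<Longrightarrow> (\<lambda>i. L (h i)) \<longlonglongrightarrow> 0"
begin

lemma E_const: "(\<lambda>x. r) \<in> E"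
  using E_scale[OF E_one, of r] by simp

lemma E_diff: "f \<in> E \<Longrightarrow> g \<in> E \<Longrightarrow> (\<lambda>x. f x - g x) \<in> E"
  using E_add[OF _ E_scale[of g "-1"], of f] by simp

lemma E_min:
  assumes "f \<in> E" "g \<in> E" shows "(\<lambda>x. min (f x) (g x)) \<in> E"
proof -
  have "(\<lambda>x. f x + g x - max (f x) (g x)) \<in> E"
    using assms by (intro E_diff E_add E_max)
  also have "(\<lambda>x. f x + g x - max (f x) (g x)) = (\<lambda>x. min (f x) (g x))"
    by (auto simp: fun_eq_iff)
  finally show ?thesis .
qed

lemma E_sum: "(\<And>i. i \<in> I \<Longrightarrow> f i \<in> E) \<Longrightarrow> (\<lambda>x. \<Sum>i\<in>I. f i x) \<in> E"
  by (induction I rule: infinite_finite_induct) (auto intro: E_add E_const)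

lemmas E_intros = E_add E_scale E_const E_max E_min E_diff E_sum

lemma L_zero: "L (\<lambda>x. 0) = 0"
  using L_scale[OF E_one, of 0] by simp

lemma L_diff: "f \<in> E \<Longrightarrow> g \<in> E \<Longrightarrow> L (\<lambda>x. f x - g x) = L f - L g"
  using L_add[OF _ E_scale[of g "-1"], of f] L_scale[of g "-1"] by simp

lemma L_sum: "(\<And>i. i \<in> I \<Longrightarrow> f i \<in> E) \<Longrightarrow> L (\<lambda>x. \<Sum>i\<in>I. f i x) = (\<Sum>i\<in>I. L (f i))"
  by (induction I rule: infinite_finite_induct) (auto simp: L_zero L_add E_sum)

lemma L_mono: "f \<in> E \<Longrightarrow> g \<in> E \<Longrightarrow> (\<And>x. x \<in> \<Omega> \<Longrightarrow> f x \<le> g x) \<Longrightarrow> L f \<le> L g"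
  using L_nonneg[OF E_diff[of g f]] L_diff[of g f] by simp

lemma L_cong: "f \<in> E \<Longrightarrow> g \<in> E \<Longrightarrow> (\<And>x. x \<in> \<Omega> \<Longrightarrow> f x = g x) \<Longrightarrow> L f = L g"
  by (intro antisym L_mono) auto

text \<open>Regions between two graphs form a semiring of sets on which \<open>L\<close> induces a premeasure:
  fibrewise Lebesgue measure reduces countable additivity to the continuity of \<open>L\<close>.\<close>
definition region :: "('b \<Rightarrow> real) \<Rightarrow> ('b \<Rightarrow> real) \<Rightarrow> ('b \<times> real) set" where
  "region f g = {(x, t). x \<in> \<Omega> \<and> f x \<le> t \<and> t < g x}"

text \<open>Without \<open>f \<le> g\<close> a fibre could be empty while \<open>g x - f x\<close>
  is negative, and the region would not determine \<open>L (g - f)\<close>.\<close>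

definition ordered :: "('b \<Rightarrow> real) \<Rightarrow> ('b \<Rightarrow> real) \<Rightarrow> bool" where
  "ordered f g \<longleftrightarrow> f \<in> E \<and> g \<in> E \<and> (\<forall>x\<in>\<Omega>. f x \<le> g x)"

text \<open>Morally the product of the measure sought with Lebesgue measure. The definition becomes
  informative through \<open>emeasure_region\<close>, which shows that the prescribed values do
  extend to a measure.\<close>

definition region_measure :: "('b \<times> real) measure" where
  "region_measure = extend_measure (\<Omega> \<times> UNIV) {(f, g). ordered f g} (\<lambda>(f, g). region f g)
    (\<lambda>(f, g). ennreal (L (\<lambda>x. g x - f x)))"

lemma emeasure_lborel_region_slice:
  "ordered f g \<Longrightarrow> x \<in> \<Omega> \<Longrightarrow> emeasure lborel (Pair x -` region f g) = ennreal (g x - f x)"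
proof -
  assume "ordered f g" "x \<in> \<Omega>"
  then have "Pair x -` region f g = {f x..<g x}" "f x \<le> g x"
    by (auto simp: region_def ordered_def)
  then show ?thesis by simp
qed

lemma semiring_region: "semiring_of_sets (\<Omega> \<times> UNIV) {region f g | f g. ordered f g}"
proof
  show "{region f g |f g. ordered f g} \<subseteq> Pow (\<Omega> \<times> UNIV)"
    by (auto simp: region_def)
  have "region (\<lambda>x. 0) (\<lambda>x. 0) = {}" "ordered (\<lambda>x. 0) (\<lambda>x. 0)"
    by (auto simp: region_def ordered_def E_const)
  then show "{} \<in> {region f g |f g. ordered f g}" by blast
next
  fix a b assume "a \<in> {region f g |f g. ordered f g}" "b \<in> {region f g |f g. ordered f g}"
  then obtain f g f' g' where
    a: "a = region f g" "ordered f g" and b: "b = region f' g'" "ordered f' g'" by blast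
  \<comment> \<open>The outer \<open>max\<close> in the upper graph keeps the pair ordered over
    points where the two fibres do not meet.\<close>
  have "a \<inter> b = region (\<lambda>x. max (f x) (f' x)) (\<lambda>x. max (min (g x) (g' x)) (max (f x) (f' x)))"
    by (auto simp: a b region_def)
  moreover have "ordered (\<lambda>x. max (f x) (f' x)) (\<lambda>x. max (min (g x) (g' x)) (max (f x) (f' x)))"
    using a b by (auto simp: ordered_def intro!: E_max E_min)
  ultimately show "a \<inter> b \<in> {region f g |f g. ordered f g}" by blast
  \<comment> \<open>What remains of each fibre lies below \<open>f'\<close> or above
    \<open>g'\<close>; both cuts are clamped to the interval from \<open>f\<close> to
    \<open>g\<close> so that the pairs are ordered.\<close>
  define lo hi where "lo = region f (\<lambda>x. max (f x) (min (g x) (f' x)))"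
    and "hi = region (\<lambda>x. min (g x) (max (f x) (g' x))) g"
  have "ordered f (\<lambda>x. max (f x) (min (g x) (f' x)))" "ordered (\<lambda>x. min (g x) (max (f x) (g' x))) g"
    using a b by (auto simp: ordered_def intro!: E_max E_min)
  then have "lo \<in> {region f g |f g. ordered f g}" "hi \<in> {region f g |f g. ordered f g}"
    unfolding lo_def hi_def by blast+
  moreover have "a - b = \<Union>{lo, hi}"
    using a b by (fastforce simp: lo_def hi_def region_def ordered_def)
  moreover have "lo \<inter> hi = {}"
    using b by (fastforce simp: lo_def hi_def region_def ordered_def)
  then have "disjoint {lo, hi}" by (auto simp: disjoint_def)
  ultimately show "\<exists>C\<subseteq>{region f g |f g. ordered f g}. finite C \<and> disjoint C \<and> a - b = \<Union>C"
    by (intro exI[of _ "{lo, hi}"]) blast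
qed

lemma emeasure_region:
  assumes "ordered f g"
  shows "emeasure region_measure (region f g) = ennreal (L (\<lambda>x. g x - f x))"
proof (rule extend_measure_caratheodory_pair[OF region_measure_def assms semiring_region])
  \<comment> \<open>Different pairs can bound the same region, since \<open>f x\<close> is arbitrary
    wherever \<open>f x = g x\<close>. The region still determines all fibre lengths on
    \<open>\<Omega>\<close>, hence \<open>L (g - f)\<close>.\<close>
  have cong: "L (\<lambda>x. g x - f x) = L (\<lambda>x. g' x - f' x)"
    if "ordered f g" "ordered f' g'" "region f g = region f' g'" for f g f' g'
  proof (rule L_cong)
    fix x assume x: "x \<in> \<Omega>"
    with that have "ennreal (g x - f x) = ennreal (g' x - f' x)"
      using emeasure_lborel_region_slice by metis
    then show "g x - f x = g' x - f' x" using that x by (auto simp: ordered_def)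
  qed (use that in \<open>auto simp: ordered_def intro: E_diff\<close>)
  then show "ennreal (L (\<lambda>x. g x - f x)) = ennreal (L (\<lambda>x. g' x - f' x))"
    if "ordered f g" "ordered f' g'" "region f g = region f' g'" for f g f' g'
    using that by metis
  show "ennreal (L (\<lambda>x. g x - f x)) = 0" if "ordered f g" "region f g = {}" for f g
  proof -
    have "region f g = region f f" using that by (auto simp: region_def)
    then show ?thesis using cong[OF that(1), of f f] that(1) by (simp add: ordered_def L_zero)
  qed
next
  fix A B :: "nat \<Rightarrow> 'b \<Rightarrow> real" and f g
  assume AB: "\<And>n. ordered (A n) (B n)" and fg: "ordered f g"
    and disj: "disjoint_family (\<lambda>n. region (A n) (B n))"
    and un: "(\<Union>n. region (A n) (B n)) = region f g"
  have E: "A n \<in> E" "B n \<in> E" "f \<in> E" "g \<in> E" for n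
    using AB fg by (auto simp: ordered_def)
  have nonneg: "0 \<le> L (\<lambda>x. B n x - A n x)" for n
    using AB E by (intro L_nonneg E_diff) (auto simp: ordered_def)
  have sums: "(\<lambda>n. B n x - A n x) sums (g x - f x)" if x: "x \<in> \<Omega>" for x
  proof -
    have le: "A n x \<le> B n x" "f x \<le> g x" for n
      using AB fg x by (auto simp: ordered_def)
    have "Pair x -` region f g = (\<Union>n. Pair x -` region (A n) (B n))"
      by (simp add: un[symmetric] vimage_UN)
    moreover have "disjoint_family (\<lambda>n. Pair x -` region (A n) (B n))"
      using disj by (fastforce simp: disjoint_family_on_def)
    moreover have "Pair x -` region f g \<in> sets lborel" for f g
    proof -
      have "Pair x -` region f g = {f x..<g x}" using x by (auto simp: region_def)
      then show ?thesis by simp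
    qed
    ultimately have "(\<Sum>n. emeasure lborel (Pair x -` region (A n) (B n))) = emeasure lborel (Pair x -` region f g)"
      by (simp add: suminf_emeasure image_subset_iff)
    then have "(\<Sum>n. ennreal (B n x - A n x)) = ennreal (g x - f x)"
      using emeasure_lborel_region_slice[OF AB x] emeasure_lborel_region_slice[OF fg x] by simp
    moreover have "(\<lambda>n. ennreal (B n x - A n x)) sums (\<Sum>n. ennreal (B n x - A n x))"
      by (rule summable_sums) simp
    ultimately show ?thesis using le by (simp add: sums_ennreal)
  qed
  \<comment> \<open>The remainder of the fibrewise series lies in \<open>E\<close> because its sum
    is the known member \<open>g - f\<close>. Being decreasing with limit 0, it is exactly what the
    continuity of \<open>L\<close> applies to.\<close>
  define R where "R m x = (g x - f x) - (\<Sum>n<m. B n x - A n x)" for m x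
  have "(\<lambda>m. L (R m)) \<longlonglongrightarrow> 0"
  proof (rule L_continuous)
    show "R m \<in> E" for m
      unfolding R_def by (intro E_diff E_sum E)
    show "R (Suc m) x \<le> R m x" if "x \<in> \<Omega>" for m x
      using AB[of m] that by (simp add: R_def ordered_def)
    show "(\<lambda>m. R m x) \<longlonglongrightarrow> 0" if "x \<in> \<Omega>" for x
      using tendsto_diff[OF tendsto_const sums[OF that, unfolded sums_def], of "g x - f x"]
      by (simp add: R_def)
  qed
  moreover have "L (R m) = L (\<lambda>x. g x - f x) - (\<Sum>n<m. L (\<lambda>x. B n x - A n x))" for m
  proof -
    have "L (R m) = L (\<lambda>x. g x - f x) - L (\<lambda>x. \<Sum>n<m. B n x - A n x)"
      unfolding R_def by (intro L_diff E_diff E_sum E)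
    also have "L (\<lambda>x. \<Sum>n<m. B n x - A n x) = (\<Sum>n<m. L (\<lambda>x. B n x - A n x))"
      by (intro L_sum E_diff E)
    finally show ?thesis .
  qed
  ultimately have "(\<lambda>m. L (\<lambda>x. g x - f x) - (L (\<lambda>x. g x - f x) - (\<Sum>n<m. L (\<lambda>x. B n x - A n x))))
      \<longlonglongrightarrow> L (\<lambda>x. g x - f x) - 0"
    by (intro tendsto_diff tendsto_const) simp
  then have "(\<lambda>n. L (\<lambda>x. B n x - A n x)) sums L (\<lambda>x. g x - f x)"
    by (simp add: sums_def)
  then show "(\<Sum>n. ennreal (L (\<lambda>x. B n x - A n x))) = ennreal (L (\<lambda>x. g x - f x))"
    using nonneg by (simp add: suminf_ennreal2 sums_iff)
qed auto

lemma sets_region_measure: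
  "sets region_measure = sigma_sets (\<Omega> \<times> UNIV) {region f g | f g. ordered f g}"
proof -
  have "(\<lambda>(f, g). region f g) ` {(f, g). ordered f g} = {region f g | f g. ordered f g}"
    by auto
  moreover have "\<dots> \<subseteq> Pow (\<Omega> \<times> UNIV)" by (auto simp: region_def)
  ultimately show ?thesis
    by (simp add: region_measure_def sets_extend_measure)
qed

lemma space_region_measure: "space region_measure = \<Omega> \<times> UNIV"
  unfolding region_measure_def by (rule space_extend_measure) (auto simp: region_def)

section \<open>Projecting the region measure to a measure on \<open>\<Omega>\<close>\<close>

definition base :: "'b measure" where
  "base = sigma \<Omega> {{x\<in>\<Omega>. a < h x} | h a. h \<in> E}"

text \<open>A set \<open>A\<close> receives the measure of the slab \<open>A \<times> [0, 1)\<close>.\<close>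
definition representing :: "'b measure" where
  "representing = distr (restrict_space region_measure (\<Omega> \<times> {0..<1})) base fst"

lemma sets_base: "sets base = sigma_sets \<Omega> {{x\<in>\<Omega>. a < h x} | h a. h \<in> E}"
  unfolding base_def by (rule sets_measure_of) auto

lemma space_base: "space base = \<Omega>"
  unfolding base_def by (rule space_measure_of) auto

lemma region_in_sets: "ordered f g \<Longrightarrow> region f g \<in> sets region_measure"
  unfolding sets_region_measure by (rule sigma_sets.Basic) auto

lemma unit_slab: "\<Omega> \<times> {0..<1} = region (\<lambda>x. 0) (\<lambda>x. 1)" "ordered (\<lambda>x. 0) (\<lambda>x. 1)"
  by (auto simp: region_def ordered_def E_const)

lemma slab_Int_space_in_sets: "\<Omega> \<times> {0..<1} \<inter> space region_measure \<in> sets region_measure"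
proof -
  have "\<Omega> \<times> {0..<1} \<inter> space region_measure = region (\<lambda>x. 0) (\<lambda>x. 1)"
    by (auto simp: space_region_measure region_def)
  then show ?thesis using region_in_sets[OF unit_slab(2)] by simp
qed

text \<open>The ramps \<open>u j\<close>, which are \<open>j * (h - a)\<close> clamped to the unit
  interval, increase to the indicator of \<open>{a < h}\<close>, so the slab is a countable union of
  regions under members of \<open>E\<close>.\<close>

lemma slab_in_sets:
  assumes h: "h \<in> E" shows "{x\<in>\<Omega>. a < h x} \<times> {0..<1} \<in> sets region_measure"
proof -
  define u where "u j x = max 0 (min 1 (real j * (h x - a)))" for j x
  have "{x\<in>\<Omega>. a < h x} \<times> {0..<1} = (\<Union>j. region (\<lambda>x. 0) (u j))"
  proof (intro equalityI subsetI; clarsimp simp: region_def)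
    fix x and t :: real assume "a < h x" "0 \<le> t" "t < 1"
    moreover obtain j :: nat where "t / (h x - a) < real j" using reals_Archimedean2 by blast
    ultimately show "\<exists>j. t < u j x" by (auto simp: u_def field_simps intro!: exI[of _ j])
  next
    fix x j and t :: real assume "0 \<le> t" "t < u j x"
    then have "t < 1" "0 < real j * (h x - a)" by (auto simp: u_def split: if_splits)
    then show "a < h x \<and> t < 1" by (auto simp: zero_less_mult_iff)
  qed
  moreover have "ordered (\<lambda>x. 0) (u j)" for j
  proof -
    have "u j \<in> E" unfolding u_def by (intro E_intros h)
    then show ?thesis by (auto simp: ordered_def u_def E_const)
  qed
  ultimately show ?thesis by (auto intro!: sets.countable_UN region_in_sets)
qed

lemma fst_measurable:
  "fst \<in> restrict_space region_measure (\<Omega> \<times> {0..<1}) \<rightarrow>\<^sub>M base"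
  unfolding base_def
proof (rule measurable_measure_of)
  have slab: "\<Omega> \<times> {0..<1} \<inter> space region_measure \<in> sets region_measure"
    by (rule slab_Int_space_in_sets)
  fix A assume "A \<in> {{x\<in>\<Omega>. a < h x} | h a. h \<in> E}"
  then obtain h a where A: "A = {x\<in>\<Omega>. a < h x}" "h \<in> E" by blast
  have "fst -` A \<inter> space (restrict_space region_measure (\<Omega> \<times> {0..<1})) = A \<times> {0..<1}"
    by (auto simp: A space_restrict_space space_region_measure)
  then show "fst -` A \<inter> space (restrict_space region_measure (\<Omega> \<times> {0..<1}))
      \<in> sets (restrict_space region_measure (\<Omega> \<times> {0..<1}))"
    using slab slab_in_sets[OF A(2), of a] by (auto simp: sets_restrict_space_iff A)
qed (auto simp: space_restrict_space)

lemma sets_representing: "sets representing = sigma_sets \<Omega> {{x\<in>\<Omega>. a < h x} | h a. h \<in> E}"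
  by (simp add: representing_def sets_base)

lemma space_representing: "space representing = \<Omega>"
  by (simp add: representing_def space_base)

lemma emeasure_representing:
  assumes "A \<in> sets representing"
  shows "emeasure representing A = emeasure region_measure (A \<times> {0..<1})"
proof -
  have slab: "\<Omega> \<times> {0..<1} \<inter> space region_measure \<in> sets region_measure"
    by (rule slab_Int_space_in_sets)
  have A: "A \<in> sets base" "A \<subseteq> \<Omega>"
    using assms sets.sets_into_space[OF assms] by (auto simp: representing_def space_base)
  have "fst -` A \<inter> space (restrict_space region_measure (\<Omega> \<times> {0..<1})) = A \<times> {0..<1}"
    using A by (auto simp: space_restrict_space space_region_measure)
  then have "emeasure representing A
      = emeasure (restrict_space region_measure (\<Omega> \<times> {0..<1})) (A \<times> {0..<1})"
    using emeasure_distr[OF fst_measurable A(1)] by (simp add: representing_def)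
  also have "\<dots> = emeasure region_measure (A \<times> {0..<1})"
    using slab A by (intro emeasure_restrict_space) auto
  finally show ?thesis .
qed

lemma emeasure_representing_space: "emeasure representing \<Omega> = ennreal (L (\<lambda>x. 1))"
  using emeasure_representing[of \<Omega>] sets.top[of representing] emeasure_region[OF unit_slab(2)] unit_slab(1)
  by (simp add: space_representing)

lemma finite_representing: "finite_measure representing"
  by (rule finite_measureI) (simp add: space_representing emeasure_representing_space)

section \<open>Integration against the representing measure recovers \<open>L\<close>\<close>

lemma borel_measurable_representing:
  assumes "h \<in> E" shows "h \<in> borel_measurable representing"
  unfolding borel_measurable_iff_greater space_representing sets_representing
  using assms by (auto intro!: sigma_sets.Basic)

text \<open>The region under \<open>v\<close> sits inside the unit slab over the superlevel set, so
  this is monotonicity of the region measure.\<close>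

lemma L_le_measure_greater:
  assumes "h \<in> E" "v \<in> E" and v: "\<And>x. x \<in> \<Omega> \<Longrightarrow> 0 \<le> v x \<and> v x \<le> of_bool (a < h x)"
  shows "L v \<le> measure representing {x\<in>\<Omega>. a < h x}"
proof -
  interpret finite_measure representing by (rule finite_representing)
  have ord: "ordered (\<lambda>x. 0) v" using assms by (auto simp: ordered_def E_const)
  have A: "{x\<in>\<Omega>. a < h x} \<in> sets representing"
    using assms(1) by (auto simp: sets_representing intro!: sigma_sets.Basic)
  have "region (\<lambda>x. 0) v \<subseteq> {x\<in>\<Omega>. a < h x} \<times> {0..<1}"
  proof (clarsimp simp: region_def)
    fix x and t :: real assume "x \<in> \<Omega>" "0 \<le> t" "t < v x"
    with v[of x] show "a < h x \<and> t < 1" by (cases "a < h x") auto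
  qed
  then have "ennreal (L v) \<le> emeasure representing {x\<in>\<Omega>. a < h x}"
    using emeasure_mono[OF _ slab_in_sets[OF assms(1), of a], of "region (\<lambda>x. 0) v"]
    by (simp add: emeasure_region[OF ord] emeasure_representing[OF A])
  then show ?thesis using A by (simp add: emeasure_eq_measure)
qed

text \<open>One inequality suffices, as it can be applied to \<open>1 - u\<close> as well. It is obtained by cutting \<open>u\<close>
  into \<open>N\<close> horizontal layers, at the cost of an error \<open>L 1 / N\<close>.\<close>
lemma L_le_integral:
  assumes u: "u \<in> E" and u01: "\<And>x. x \<in> \<Omega> \<Longrightarrow> 0 \<le> u x \<and> u x \<le> 1"
  shows "L u \<le> (\<integral>x. u x \<partial>representing)"
proof (rule field_le_epsilon)
  interpret finite_measure representing by (rule finite_representing)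
  fix e :: real assume e: "e > 0"
  have L1: "0 \<le> L (\<lambda>x. 1)" by (rule L_nonneg) (auto intro: E_const)
  obtain N :: nat where N: "N > 0" "L (\<lambda>x. 1) / e < real N"
    using reals_Archimedean2[of "L (\<lambda>x. 1) / e"] L1 e
    by (metis divide_nonneg_pos of_nat_0_less_iff order_le_less_trans)
  have int: "integrable representing u"
    using u01 borel_measurable_representing[OF u]
    by (intro integrable_const_bound[of _ 1]) (auto simp: space_representing intro!: AE_I2)
  define v where "v j x = max 0 (min 1 (real N * u x - real j))" for j x
  define A where "A j = {x\<in>\<Omega>. real j < real N * u x}" for j
  have vE: "v j \<in> E" for j unfolding v_def by (intro E_intros u)
  have A: "A j \<in> sets representing" for j
    unfolding A_def sets_representing using E_scale[OF u] by (auto intro!: sigma_sets.Basic)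
  have "real N * L u = L (\<lambda>x. real N * u x)" by (simp add: L_scale u)
  also have "\<dots> = L (\<lambda>x. \<Sum>j<N. v j x)"
  proof (rule L_cong)
    fix x assume x: "x \<in> \<Omega>"
    have "(\<Sum>j<N. v j x) = min (real N * u x) (real N)"
      unfolding v_def using u01[OF x] by (intro sum_clamp_layers) auto
    moreover have "real N * u x \<le> real N"
      using u01[OF x] mult_left_mono[of "u x" 1 "real N"] by simp
    ultimately show "real N * u x = (\<Sum>j<N. v j x)" by simp
  qed (intro E_intros u vE)+
  also have "\<dots> = (\<Sum>j<N. L (v j))" by (rule L_sum) (rule vE)
  also have "\<dots> \<le> (\<Sum>j<N. measure representing (A j))"
    unfolding A_def by (intro sum_mono L_le_measure_greater vE E_scale u) (auto simp: v_def)
  also have "\<dots> = (\<integral>x. (\<Sum>j<N. indicator (A j) x) \<partial>representing)"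
    using A by (subst Bochner_Integration.integral_sum)
      (auto simp: less_top[symmetric] emeasure_finite sets.Int_space_eq2)
  also have "\<dots> \<le> (\<integral>x. real N * u x + 1 \<partial>representing)"
  proof (rule integral_mono)
    show "integrable representing (\<lambda>x. \<Sum>j<N. indicator (A j) x :: real)"
      using A by (auto intro!: Bochner_Integration.integrable_sum simp: less_top[symmetric] emeasure_finite)
    show "integrable representing (\<lambda>x. real N * u x + 1)" using int by simp
    fix x assume "x \<in> space representing"
    then have x: "x \<in> \<Omega>" by (simp add: space_representing)
    have "(\<Sum>j<N. indicator (A j) x) = (\<Sum>j<N. of_bool (real j < real N * u x))"
      using x by (intro sum.cong) (auto simp: A_def indicator_def)
    also have "\<dots> \<le> real N * u x + 1"
      using u01[OF x] by (intro sum_layer_indicators_le) auto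
    finally show "(\<Sum>j<N. indicator (A j) x) \<le> real N * u x + 1" .
  qed
  also have "\<dots> = real N * (\<integral>x. u x \<partial>representing) + L (\<lambda>x. 1)"
    using int L1 by (simp add: measure_def space_representing emeasure_representing_space)
  also have "\<dots> \<le> real N * (\<integral>x. u x \<partial>representing) + real N * e"
    using N e by (simp add: field_simps)
  finally have "real N * L u \<le> real N * ((\<integral>x. u x \<partial>representing) + e)" by (simp add: algebra_simps)
  then show "L u \<le> (\<integral>x. u x \<partial>representing) + e" using N by simp
qed

lemma integral_representing_unit:
  assumes u: "u \<in> E" and u01: "\<And>x. x \<in> \<Omega> \<Longrightarrow> 0 \<le> u x \<and> u x \<le> 1"
  shows "integrable representing u" "(\<integral>x. u x \<partial>representing) = L u"
proof -
  interpret finite_measure representing by (rule finite_representing)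
  have L1: "0 \<le> L (\<lambda>x. 1)" by (rule L_nonneg) (auto intro: E_const)
  show int: "integrable representing u"
    using u01 borel_measurable_representing[OF u]
    by (intro integrable_const_bound[of _ 1]) (auto simp: space_representing intro!: AE_I2)
  have "L (\<lambda>x. 1 - u x) \<le> (\<integral>x. 1 - u x \<partial>representing)"
    using u01 by (intro L_le_integral E_intros u) auto
  also have "\<dots> = L (\<lambda>x. 1) - (\<integral>x. u x \<partial>representing)"
    using int L1 by (simp add: measure_def space_representing emeasure_representing_space)
  finally have "(\<integral>x. u x \<partial>representing) \<le> L u"
    using L_diff[OF E_const u] by simp
  with L_le_integral[OF assms] show "(\<integral>x. u x \<partial>representing) = L u" by simp
qed

text \<open>Truncations of \<open>h\<close>, rescaled into the unit interval, are covered by the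
  previous lemma. In the limit, monotone convergence handles the integral, and the continuity of
  \<open>L\<close> along \<open>h - H N\<close> handles the functional.\<close>

lemma integral_representing_nonneg:
  assumes h: "h \<in> E" and h0: "\<And>x. x \<in> \<Omega> \<Longrightarrow> 0 \<le> h x"
  shows "has_bochner_integral representing h (L h)"
proof (rule has_bochner_integral_monotone_convergence)
  \<comment> \<open>\<open>Suc N\<close> rather than \<open>N\<close>, because the truncation is
    divided by its level.\<close>
  define H where "H N x = min (h x) (real (Suc N))" for N x
  have HE: "H N \<in> E" for N unfolding H_def by (intro E_intros h)
  have *: "integrable representing (H N)" "(\<integral>x. H N x \<partial>representing) = L (H N)" for N
  proof -
    have uE: "(\<lambda>x. 1 / real (Suc N) * H N x) \<in> E" by (intro E_intros HE)
    have u01: "0 \<le> 1 / real (Suc N) * H N x \<and> 1 / real (Suc N) * H N x \<le> 1" if "x \<in> \<Omega>" for x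
      using h0[OF that] by (auto simp: H_def)
    have eq: "H N = (\<lambda>x. real (Suc N) * (1 / real (Suc N) * H N x))" by (auto simp del: of_nat_Suc)
    note I = integral_representing_unit[OF uE u01]
    show "integrable representing (H N)"
      by (subst eq) (rule integrable_mult_right, use I(1) in simp)
    have "(\<integral>x. H N x \<partial>representing) = real (Suc N) * (\<integral>x. 1 / real (Suc N) * H N x \<partial>representing)"
      by (subst eq) (rule integral_mult_right_zero)
    also have "\<dots> = L (H N)" using I(2) L_scale[OF HE, of "1 / real (Suc N)"] by (simp del: of_nat_Suc)
    finally show "(\<integral>x. H N x \<partial>representing) = L (H N)" .
  qed
  show "\<And>N. integrable representing (H N)" by (rule *)
  show "AE x in representing. mono (\<lambda>N. H N x)"
    by (intro AE_I2 incseq_SucI) (auto simp: H_def)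
  show "AE x in representing. (\<lambda>N. H N x) \<longlonglongrightarrow> h x"
  proof (intro AE_I2 tendsto_eventually)
    fix x
    obtain N0 :: nat where "h x \<le> real N0" using real_arch_simple by blast
    then show "\<forall>\<^sub>F N in sequentially. H N x = h x"
      unfolding eventually_sequentially H_def by (intro exI[of _ N0]) auto
  qed
  have "(\<lambda>N. L (\<lambda>x. h x - H N x)) \<longlonglongrightarrow> 0"
  proof (rule L_continuous)
    show "(\<lambda>x. h x - H N x) \<in> E" for N by (intro E_intros h HE)
    show "h x - H (Suc N) x \<le> h x - H N x" for N x by (auto simp: H_def)
    show "(\<lambda>N. h x - H N x) \<longlonglongrightarrow> 0" for x
    proof (rule tendsto_eventually)
      obtain N0 :: nat where "h x \<le> real N0" using real_arch_simple by blast
      then show "\<forall>\<^sub>F N in sequentially. h x - H N x = 0"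
        unfolding eventually_sequentially H_def by (intro exI[of _ N0]) auto
    qed
  qed
  then have "(\<lambda>N. L h - (L h - L (H N))) \<longlonglongrightarrow> L h - 0"
    by (intro tendsto_diff tendsto_const) (simp add: L_diff[OF h HE])
  then show "(\<lambda>N. \<integral>x. H N x \<partial>representing) \<longlonglongrightarrow> L h" by (simp add: *)
  show "h \<in> borel_measurable representing" by (rule borel_measurable_representing[OF h])
qed

theorem integral_representing:
  assumes h: "h \<in> E" shows "integrable representing h" "(\<integral>x. h x \<partial>representing) = L h"
proof -
  have E: "(\<lambda>x. max 0 (h x)) \<in> E" "(\<lambda>x. max 0 (h x) - h x) \<in> E"
    by (intro E_intros h)+
  have "has_bochner_integral representing (\<lambda>x. max 0 (h x) - (max 0 (h x) - h x))
      (L (\<lambda>x. max 0 (h x)) - L (\<lambda>x. max 0 (h x) - h x))"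
    using E by (intro has_bochner_integral_diff integral_representing_nonneg) auto
  then have "has_bochner_integral representing h (L h)"
    using L_diff[OF E(1) h] by simp
  then show "integrable representing h" "(\<integral>x. h x \<partial>representing) = L h"
    by (simp_all add: has_bochner_integral_iff)
qed

end

section \<open>Borel probability measures on Polish spaces\<close>

lemma sets_borel_of_openin: "openin T U \<Longrightarrow> U \<in> sets (borel_of T)"
  by (auto simp: sets_borel_of)

lemma sets_borel_of_closedin:
  assumes "closedin T C" shows "C \<in> sets (borel_of T)"
proof -
  have "topspace T - (topspace T - C) \<in> sets (borel_of T)"
    using assms sets.compl_sets[OF sets_borel_of_openin[of T "topspace T - C"]] by (simp add: closedin_def)
  then show ?thesis using closedin_subset[OF assms] by (simp add: double_diff)
qed

lemma continuous_map_measurable_borel_of: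
  assumes "continuous_map S T f" shows "f \<in> borel_of S \<rightarrow>\<^sub>M borel_of T"
  unfolding borel_of_def[of T]
proof (rule measurable_measure_of)
  show "{U. openin T U} \<subseteq> Pow (topspace T)" by (auto dest: openin_subset)
  show "f \<in> space (borel_of S) \<rightarrow> topspace T"
    using continuous_map_image_subset_topspace[OF assms] by auto
  show "f -` U \<inter> space (borel_of S) \<in> sets (borel_of S)" if "U \<in> {U. openin T U}" for U
  proof -
    have "f -` U \<inter> space (borel_of S) = {x \<in> topspace S. f x \<in> U}" by auto
    then show ?thesis using openin_continuous_map_preimage[OF assms] that
      by (auto intro: sets_borel_of_openin)
  qed
qed

lemma borel_of_euclidean: "borel_of euclidean = (borel :: 'a::topological_space measure)"
  by (simp add: borel_of_def borel_def)

lemma borel_prob_space: "borel_prob T M \<Longrightarrow> space M = topspace T"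
  by (metis borel_prob_def sets_eq_imp_space_eq space_borel_of)

lemma continuous_map_borel_measurable:
  assumes "borel_prob T M" "continuous_map T euclideanreal f"
  shows "f \<in> borel_measurable M"
  using continuous_map_measurable_borel_of[OF assms(2)] assms(1)
  by (simp add: borel_of_euclidean borel_prob_def cong: measurable_cong_sets)

lemma bounded_CL1:
  assumes M: "borel_prob T M" and f: "continuous_map T euclideanreal f"
    and b: "\<And>x. x \<in> topspace T \<Longrightarrow> \<bar>f x\<bar> \<le> b"
  shows "f \<in> CL1 T M"
proof -
  interpret prob_space M using M by (simp add: borel_prob_def)
  have "integrable M f"
    using b by (intro integrable_const_bound[of _ b] AE_I2 continuous_map_borel_measurable[OF M f])
      (simp add: borel_prob_space[OF M])
  then show ?thesis using f by (simp add: CL1_def)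
qed

section \<open>Testing Borel measures against continuous functions\<close>

lemma closedin_openin_bump:
  assumes "metrizable_space T" "closedin T C" "openin T U" "C \<subseteq> U"
  obtains f where "continuous_map T euclideanreal f" "\<And>x. x \<in> topspace T \<Longrightarrow> 0 \<le> f x \<and> f x \<le> 1"
    "\<And>x. x \<in> C \<Longrightarrow> f x = 1" "\<And>x. x \<in> topspace T \<Longrightarrow> x \<notin> U \<Longrightarrow> f x = (0::real)"
proof -
  have "closedin T (topspace T - U)" "disjnt (topspace T - U) C"
    using assms by (auto simp: disjnt_def)
  then obtain f where f: "continuous_map T (top_of_set {0..1::real}) f"
      "f ` (topspace T - U) \<subseteq> {0}" "f ` C \<subseteq> {1}"
    using Urysohn_lemma[of T "topspace T - U" C "0::real" 1] metrizable_imp_normal_space assms by auto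
  have "continuous_map T euclideanreal f" "f ` topspace T \<subseteq> {0..1}"
    using f(1) by (auto simp: continuous_map_in_subtopology)
  then show thesis using f(2,3) by (intro that[of f]) (auto simp: image_subset_iff)
qed

text \<open>In a metrizable space \<open>U\<close> is an increasing union of closed sets
  \<open>C n\<close>. A continuous function squeezed between the indicators of \<open>C n\<close>
  and \<open>U\<close> carries the estimate from \<open>M\<close> to \<open>N\<close>.\<close>

lemma emeasure_openin_le_of_integrals:
  assumes T: "metrizable_space T" and M: "borel_prob T M" and N: "borel_prob T N"
    and eq: "\<And>f. continuous_map T euclideanreal f \<Longrightarrow> (\<And>x. x \<in> topspace T \<Longrightarrow> 0 \<le> f x \<and> f x \<le> 1) \<Longrightarrow>
      (\<integral>x. f x \<partial>M) = (\<integral>x. f x \<partial>N)"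
    and U: "openin T U"
  shows "emeasure M U \<le> emeasure N U"
proof -
  interpret M: prob_space M using M by (simp add: borel_prob_def)
  interpret N: prob_space N using N by (simp add: borel_prob_def)
  have sets: "sets M = sets (borel_of T)" "sets N = sets (borel_of T)"
    using M N by (simp_all add: borel_prob_def)
  obtain C where C: "\<And>n. closedin T (C n)" "\<And>n. C n \<subseteq> C (Suc n)" "\<Union>(range C) = U"
    using open_imp_fsigma_in[OF T U] unfolding fsigma_in_ascending by blast
  have "emeasure M (C n) \<le> emeasure N U" for n :: nat
  proof -
    have "C n \<subseteq> U" using C(3) by blast
    then obtain f where f: "continuous_map T euclideanreal f"
        "\<And>x. x \<in> topspace T \<Longrightarrow> 0 \<le> f x \<and> f x \<le> 1" "\<And>x. x \<in> C n \<Longrightarrow> f x = 1"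
        "\<And>x. x \<in> topspace T \<Longrightarrow> x \<notin> U \<Longrightarrow> f x = (0::real)"
      using closedin_openin_bump[OF T C(1) U] by metis
    have int: "integrable M f" "integrable N f"
      using bounded_CL1[OF M f(1), of 1] bounded_CL1[OF N f(1), of 1] f(2) by (auto simp: CL1_def)
    have mC: "C n \<in> sets M" using C(1) by (simp add: sets sets_borel_of_closedin)
    have mU: "U \<in> sets N" using U by (simp add: sets sets_borel_of_openin)
    have "measure M (C n) = (\<integral>x. indicator (C n) x \<partial>M)" using mC by simp
    also have "\<dots> \<le> (\<integral>x. f x \<partial>M)"
    proof (rule integral_mono)
      show "integrable M (indicator (C n) :: _ \<Rightarrow> real)"
        using mC by (simp add: integrable_indicator_iff less_top[symmetric])
    qed (use int f \<open>C n \<subseteq> U\<close> in \<open>auto simp: borel_prob_space[OF M] indicator_def\<close>)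
    also have "\<dots> = (\<integral>x. f x \<partial>N)" using f by (intro eq) auto
    also have "\<dots> \<le> (\<integral>x. indicator U x \<partial>N)"
    proof (rule integral_mono)
      show "integrable N (indicator (U) :: _ \<Rightarrow> real)"
        using mU by (simp add: integrable_indicator_iff less_top[symmetric])
    qed (use int f \<open>C n \<subseteq> U\<close> in \<open>auto simp: borel_prob_space[OF N] indicator_def\<close>)
    also have "\<dots> = measure N U" using mU by simp
    finally show ?thesis by (simp add: M.emeasure_eq_measure N.emeasure_eq_measure)
  qed
  moreover have "(SUP n. emeasure M (C n)) = emeasure M U"
    using C by (subst SUP_emeasure_incseq) (auto simp: sets sets_borel_of_closedin intro!: incseq_SucI)
  ultimately show ?thesis by (metis SUP_least)
qed

text \<open>Open sets form an intersection-stable generator. The criterion serves to identify the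
  marginals of the measure built from \<open>L\<close>, about which only integrals of continuous
  functions are known.\<close>

lemma borel_prob_eqI:
  assumes T: "metrizable_space T" and M: "borel_prob T M" and N: "borel_prob T N"
    and eq: "\<And>f. continuous_map T euclideanreal f \<Longrightarrow> (\<And>x. x \<in> topspace T \<Longrightarrow> 0 \<le> f x \<and> f x \<le> 1) \<Longrightarrow>
      (\<integral>x. f x \<partial>M) = (\<integral>x. f x \<partial>N)"
  shows "M = N"
proof (rule measure_eqI_generator_eq[where E = "{U. openin T U}" and A = "\<lambda>_. topspace T" and \<Omega> = "topspace T"])
  interpret M: prob_space M using M by (simp add: borel_prob_def)
  show "Int_stable {U. openin T U}" by (auto simp: Int_stable_def)
  show "{U. openin T U} \<subseteq> Pow (topspace T)" by (auto dest: openin_subset)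
  show "emeasure M U = emeasure N U" if "U \<in> {U. openin T U}" for U
  proof (rule antisym)
    show "emeasure M U \<le> emeasure N U"
      using that by (intro emeasure_openin_le_of_integrals[OF T M N eq]) auto
    show "emeasure N U \<le> emeasure M U"
      using that by (intro emeasure_openin_le_of_integrals[OF T N M eq[symmetric]]) auto
  qed
  show "sets M = sigma_sets (topspace T) {U. openin T U}" "sets N = sigma_sets (topspace T) {U. openin T U}"
    using M N by (auto simp: borel_prob_def sets_borel_of)
qed (use M in \<open>auto simp: borel_prob_def prob_space_def finite_measure.emeasure_finite\<close>)

text \<open>At each scale \<open>r j\<close>, finitely many closed balls around a dense sequence
  carry all but \<open>e / 2 ^ (j + 1)\<close> of the mass. The intersection of these finite unions
  is closed and totally bounded, hence compact by completeness, and the losses sum to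
  \<open>e\<close>.\<close>

lemma ulam_tightness:
  assumes T: "polish_topology T" and P: "borel_prob T P" and e: "0 < e"
  obtains K where "compactin T K" "measure P (topspace T - K) \<le> e"
proof -
  interpret P: prob_space P using P by (simp add: borel_prob_def)
  have sP: "sets P = sets (borel_of T)" using P by (simp add: borel_prob_def)
  obtain M d where "Metric_space M d" and mc: "Metric_space.mcomplete M d"
    and Td: "T = Metric_space.mtopology M d"
    using T unfolding polish_topology_def completely_metrizable_space_def by blast
  interpret Metric_space M d by fact
  have M: "topspace T = M" by (simp add: Td)
  obtain D where D: "countable D" "D \<subseteq> M" "T closure_of D = M"
    using T M unfolding polish_topology_def separable_space_def by metis
  have "M \<noteq> {}" using P.not_empty borel_prob_space[OF P] M by simp
  then have Dne: "D \<noteq> {}" using D by auto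
  define c where "c = from_nat_into D"
  have c: "range c = D" unfolding c_def using D Dne by (simp add: range_from_nat_into)
  define r where "r j = inverse (real (Suc j))" for j
  have rpos: "0 < r j" for j by (simp add: r_def)
  define F where "F j N = (\<Union>i\<le>N. mcball (c i) (r j))" for j N :: nat
  have Fcl: "closedin T (F j N)" for j N
    unfolding F_def Td by (intro closedin_Union) auto
  then have Fs: "F j N \<in> sets P" for j N by (simp add: sP sets_borel_of_closedin)
  have FU: "(\<Union>N. F j N) = M" for j
  proof
    show "(\<Union>N. F j N) \<subseteq> M" by (auto simp: F_def)
    show "M \<subseteq> (\<Union>N. F j N)"
    proof
      fix x assume x: "x \<in> M"
      then have "x \<in> mtopology closure_of D" using D by (simp add: Td)
      then obtain y where "y \<in> D" "y \<in> mball x (r j)"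
        unfolding metric_closure_of using rpos by blast
      moreover from this obtain i where "y = c i" using c by blast
      ultimately have "x \<in> mcball (c i) (r j)" using commute by simp
      then have "x \<in> F j i" unfolding F_def by blast
      then show "x \<in> (\<Union>N. F j N)" by blast
    qed
  qed
  have "\<exists>N. measure P (M - F j N) < e * (1 / 2) ^ Suc j" for j
  proof -
    have "(\<lambda>N. measure P (M - F j N)) \<longlonglongrightarrow> measure P (\<Inter>N. M - F j N)"
    proof (rule P.finite_Lim_measure_decseq)
      show "range (\<lambda>N. M - F j N) \<subseteq> P.events"
        using Fs sets.top[of P] borel_prob_space[OF P] M by auto
      show "decseq (\<lambda>N. M - F j N)" unfolding decseq_def F_def by force
    qed
    also have "(\<Inter>N. M - F j N) = {}" using FU by blast
    finally have "(\<lambda>N. measure P (M - F j N)) \<longlonglongrightarrow> 0" by simp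
    from order_tendstoD(2)[OF this, of "e * (1 / 2) ^ Suc j"] e
    show ?thesis by (auto simp: eventually_sequentially)
  qed
  then obtain N where N: "\<And>j. measure P (M - F j (N j)) < e * (1 / 2) ^ Suc j" by metis
  define K where "K = (\<Inter>j. F j (N j))"
  have Kcl: "closedin T K" unfolding K_def using Fcl by blast
  have "mtotally_bounded K"
    unfolding mtotally_bounded_def
  proof (intro allI impI)
    fix \<epsilon> :: real assume "0 < \<epsilon>"
    then obtain j where j: "r j < \<epsilon> / 2" unfolding r_def using reals_Archimedean[of "\<epsilon> / 2"] by auto
    \<comment> \<open>Total boundedness asks for centres inside \<open>K\<close>, where the
      \<open>c i\<close> need not lie. Each ball meeting \<open>K\<close> gets a new centre in
      \<open>K\<close>, which doubles the radius; hence the choice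
      \<open>r j < \<epsilon> / 2\<close>.\<close>
    define J where "J = {i. i \<le> N j \<and> K \<inter> mcball (c i) (r j) \<noteq> {}}"
    have "\<forall>i\<in>J. \<exists>z. z \<in> K \<inter> mcball (c i) (r j)" unfolding J_def by blast
    then obtain y where y: "\<And>i. i \<in> J \<Longrightarrow> y i \<in> K \<inter> mcball (c i) (r j)" by metis
    have "K \<subseteq> (\<Union>x\<in>y ` J. mball x \<epsilon>)"
    proof
      fix x assume x: "x \<in> K"
      then have "x \<in> F j (N j)" by (simp add: K_def)
      then obtain i where i: "i \<le> N j" "x \<in> mcball (c i) (r j)" by (auto simp: F_def)
      then have iJ: "i \<in> J" using x by (auto simp: J_def)
      have *: "d (c i) (y i) \<le> r j" "d (c i) x \<le> r j" "c i \<in> M" "y i \<in> M" "x \<in> M"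
        using y[OF iJ] i by auto
      then have "d (y i) x < \<epsilon>"
        using triangle[of "y i" "c i" x] commute[of "y i" "c i"] j by linarith
      then have "x \<in> mball (y i) \<epsilon>" using * by simp
      then show "x \<in> (\<Union>x\<in>y ` J. mball x \<epsilon>)" using iJ by blast
    qed
    moreover have "finite (y ` J)" by (simp add: J_def)
    moreover have "y ` J \<subseteq> K" using y by blast
    ultimately show "\<exists>K'. finite K' \<and> K' \<subseteq> K \<and> K \<subseteq> (\<Union>x\<in>K'. mball x \<epsilon>)"
      by (intro exI[of _ "y ` J"]) simp
  qed
  then have "compactin mtopology (mtopology closure_of K)"
    using mtotally_bounded_eq_compact_closure_of[OF mc] by blast
  then have "compactin T K" using Kcl by (simp add: Td closure_of_closedin)
  moreover have "measure P (topspace T - K) \<le> e"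
  proof -
    have sums: "(\<lambda>j. e * (1 / 2) ^ Suc j) sums (e * 1)"
      using sums_mult[OF power_half_series, of e] by simp
    have summ: "summable (\<lambda>j. measure P (M - F j (N j)))"
      by (rule summable_comparison_test[OF _ sums_summable[OF sums]])
        (use N in \<open>auto intro!: exI[of _ 0] less_imp_le\<close>)
    have "topspace T - K = (\<Union>j. M - F j (N j))" by (auto simp: M K_def)
    moreover have "range (\<lambda>j. M - F j (N j)) \<subseteq> P.events"
      using Fs sets.top[of P] borel_prob_space[OF P] M by auto
    ultimately have "measure P (topspace T - K) \<le> (\<Sum>j. measure P (M - F j (N j)))"
      using P.finite_measure_subadditive_countably[OF _ summ] by metis
    also have "\<dots> \<le> (\<Sum>j. e * (1 / 2) ^ Suc j)"
      using N summ sums_summable[OF sums] by (intro suminf_le) (auto intro: less_imp_le)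
    also have "\<dots> = e" using sums_unique[OF sums] by simp
    finally show ?thesis .
  qed
  ultimately show thesis by (rule that)
qed

text \<open>The tube lemma for finitely many factors, by induction from Wallace's theorem for two.
  The open box it yields makes leaving the neighbourhood \<open>U\<close> visible in a single
  coordinate.\<close>

lemma tube_product_topology:
  assumes "finite I" "openin (product_topology X I) U" "\<And>k. k \<in> I \<Longrightarrow> compactin (X k) (K k)"
    "PiE I K \<subseteq> U"
  obtains V where "\<And>k. k \<in> I \<Longrightarrow> openin (X k) (V k)" "\<And>k. k \<in> I \<Longrightarrow> K k \<subseteq> V k" "PiE I V \<subseteq> U"
proof -
  have "\<exists>V. (\<forall>k\<in>I. openin (X k) (V k) \<and> K k \<subseteq> V k) \<and> PiE I V \<subseteq> U"
    using assms
  proof (induction I arbitrary: U rule: finite_induct)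
    case empty
    then show ?case by simp
  next
    case (insert i I)
    \<comment> \<open>\<open>\<phi>\<close> inserts a value at coordinate \<open>i\<close>, passing
      from the binary product to the product over \<open>insert i I\<close>; its continuity lets
      \<open>U\<close> be pulled back.\<close>
    define \<phi> where "\<phi> = (\<lambda>p. (snd p)(i := fst p) :: 'a \<Rightarrow> 'b)"
    have cont: "continuous_map (prod_topology (X i) (product_topology X I)) (product_topology X (insert i I)) \<phi>"
      unfolding continuous_map_componentwise
    proof (intro conjI ballI)
      show "\<phi> ` topspace (prod_topology (X i) (product_topology X I)) \<subseteq> extensional (insert i I)"
        by (auto simp: \<phi>_def extensional_def PiE_def)
      fix k assume k: "k \<in> insert i I"
      show "continuous_map (prod_topology (X i) (product_topology X I)) (X k) (\<lambda>p. \<phi> p k)"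
      proof (cases "k = i")
        case True then show ?thesis by (simp add: \<phi>_def continuous_map_fst)
      next
        case False
        then have "(\<lambda>p. \<phi> p k) = (\<lambda>f. f k) \<circ> snd" by (auto simp: \<phi>_def)
        then show ?thesis using k False
          by (simp only:) (intro continuous_map_compose[OF continuous_map_snd continuous_map_product_projection], auto)
      qed
    qed
    define W where "W = {p \<in> topspace (prod_topology (X i) (product_topology X I)). \<phi> p \<in> U}"
    have W: "openin (prod_topology (X i) (product_topology X I)) W"
      unfolding W_def using cont insert.prems(1) by (rule openin_continuous_map_preimage)
    have KPi: "compactin (product_topology X I) (PiE I K)"
      using insert.prems(2) by (simp add: compactin_PiE)
    have Ki: "compactin (X i) (K i)" using insert.prems(2) by simp
    have "K i \<times> PiE I K \<subseteq> W"
    proof clarify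
      fix a g assume ag: "a \<in> K i" "g \<in> PiE I K"
      then have "\<phi> (a, g) \<in> PiE (insert i I) K"
        by (auto simp: \<phi>_def PiE_def extensional_def)
      then show "(a, g) \<in> W"
        using ag insert.prems(3) compactin_subset_topspace[OF Ki] compactin_subset_topspace[OF KPi]
        by (auto simp: W_def)
    qed
    then obtain A B where AB: "openin (X i) A" "openin (product_topology X I) B"
      "K i \<subseteq> A" "PiE I K \<subseteq> B" "A \<times> B \<subseteq> W"
      using Wallace_theorem_prod_topology[OF Ki KPi W] by blast
    then obtain V where V: "\<forall>k\<in>I. openin (X k) (V k) \<and> K k \<subseteq> V k" "PiE I V \<subseteq> B"
      using insert.IH[of B] insert.prems(2) by auto
    have "PiE (insert i I) (V(i := A)) \<subseteq> U"
    proof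
      fix x assume x: "x \<in> PiE (insert i I) (V(i := A))"
      have "restrict x I \<in> PiE I V"
        using x insert.hyps(2) by (auto simp: PiE_iff split: if_splits)
      moreover have "x i \<in> A" using x by (auto simp: PiE_iff)
      ultimately have "(x i, restrict x I) \<in> W" using V(2) AB(5) by blast
      moreover have "\<phi> (x i, restrict x I) = x"
        using x by (auto simp: \<phi>_def PiE_iff extensional_def fun_eq_iff)
      ultimately show "x \<in> U" by (simp add: W_def)
    qed
    moreover have "\<forall>k\<in>insert i I. openin (X k) ((V(i := A)) k) \<and> K k \<subseteq> (V(i := A)) k"
      using V(1) AB(1,3) by simp
    ultimately show ?case by blast
  qed
  then show thesis using that by blast
qed

section \<open>Duality\<close>

lemma CL1_add: "f \<in> CL1 T M \<Longrightarrow> g \<in> CL1 T M \<Longrightarrow> (\<lambda>x. f x + g x) \<in> CL1 T M"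
  by (auto simp: CL1_def intro: continuous_intros)

lemma CL1_scale: "f \<in> CL1 T M \<Longrightarrow> (\<lambda>x. r * f x) \<in> CL1 T M"
  by (auto simp: CL1_def intro: continuous_map_real_mult_left)

lemma CL1_abs: "f \<in> CL1 T M \<Longrightarrow> (\<lambda>x. \<bar>f x\<bar>) \<in> CL1 T M"
  by (auto simp: CL1_def intro: continuous_intros)

lemma CL1_const: "borel_prob T M \<Longrightarrow> (\<lambda>x. r) \<in> CL1 T M"
  by (rule bounded_CL1[of _ _ _ "\<bar>r\<bar>"]) auto

lemma CL1_excess: "borel_prob T M \<Longrightarrow> f \<in> CL1 T M \<Longrightarrow> (\<lambda>x. max 0 (f x - R)) \<in> CL1 T M"
proof -
  assume M: "borel_prob T M" and f: "f \<in> CL1 T M"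
  have g: "(\<lambda>x. f x + - R) \<in> CL1 T M" by (intro CL1_add f CL1_const M)
  then show "(\<lambda>x. max 0 (f x - R)) \<in> CL1 T M"
    by (auto simp: CL1_def intro: continuous_map_real_max)
qed

lemma CL1_integrable: "f \<in> CL1 T M \<Longrightarrow> integrable M f"
  by (simp add: CL1_def)

text \<open>Dominated convergence with bound \<open>\<bar>f x\<bar>\<close>; it permits cutting an
  unbounded function at a finite level with little loss.\<close>

lemma CL1_excess_tendsto:
  assumes M: "borel_prob T M" and f: "f \<in> CL1 T M"
  shows "(\<lambda>R. \<integral>x. max 0 (f x - real R) \<partial>M) \<longlonglongrightarrow> 0"
proof -
  have "(\<lambda>R. \<integral>x. max 0 (f x - real R) \<partial>M) \<longlonglongrightarrow> (\<integral>x. 0 \<partial>M)"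
  proof (rule integral_dominated_convergence[where w = "\<lambda>x. \<bar>f x\<bar>"])
    show "integrable M (\<lambda>x. \<bar>f x\<bar>)" using f by (simp add: CL1_def)
    show "(\<lambda>x. max 0 (f x - real R)) \<in> borel_measurable M" for R
      using CL1_excess[OF M f] by (auto simp: CL1_def)
    show "AE x in M. (\<lambda>R. max 0 (f x - real R)) \<longlonglongrightarrow> 0"
    proof (intro AE_I2 tendsto_eventually)
      fix x
      obtain R0 :: nat where "f x \<le> real R0" using real_arch_simple by blast
      then show "\<forall>\<^sub>F R in sequentially. max 0 (f x - real R) = 0"
        unfolding eventually_sequentially by (intro exI[of _ R0]) auto
    qed
    show "AE x in M. norm (max 0 (f x - real R)) \<le> \<bar>f x\<bar>" for R
      by (intro AE_I2) auto
  qed simp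
  then show ?thesis by simp
qed

section \<open>Additively separable functions and the vector lattice \<open>CL\<close>\<close>

locale marginals =
  fixes n :: nat and X :: "nat \<Rightarrow> 'a topology" and \<mu> :: "nat \<Rightarrow> 'a measure"
  assumes n_pos: "n \<ge> 1"
    and polish: "\<And>k. k \<in> {1..n} \<Longrightarrow> polish_topology (X k)"
    and prob: "\<And>k. k \<in> {1..n} \<Longrightarrow> borel_prob (X k) (\<mu> k)"
begin

text \<open>Additive separability: the tuple \<open>f\<close> stands for the function
  \<open>\<Sum>k. f k (x k)\<close> on the product. There is no connection with
  \<open>separable_space\<close>.\<close>

definition separable_fun :: "(nat \<Rightarrow> 'a \<Rightarrow> real) \<Rightarrow> bool" where
  "separable_fun f \<longleftrightarrow> (\<forall>k\<in>{1..n}. f k \<in> CL1 (X k) (\<mu> k))"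

abbreviation total :: "(nat \<Rightarrow> 'a \<Rightarrow> real) \<Rightarrow> real" where
  "total f \<equiv> (\<Sum>k=1..n. \<integral>x. f k x \<partial>\<mu> k)"

lemma metrizable_factor: "k \<in> {1..n} \<Longrightarrow> metrizable_space (X k)"
  using polish by (simp add: polish_topology_def completely_metrizable_imp_metrizable_space)

lemma metrizable_prod: "metrizable_space (prod_top n X)"
  using polish by (intro completely_metrizable_imp_metrizable_space)
    (simp add: completely_metrizable_space_product_topology polish_topology_def)

lemma separable_fun_add: "separable_fun f \<Longrightarrow> separable_fun g \<Longrightarrow> separable_fun (\<lambda>k x. f k x + g k x)"
  by (simp add: separable_fun_def CL1_add)

lemma separable_fun_scale: "separable_fun f \<Longrightarrow> separable_fun (\<lambda>k x. r * f k x)"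
  by (simp add: separable_fun_def CL1_scale)

lemma separable_fun_zero: "separable_fun (\<lambda>k x. 0)"
  using prob by (simp add: separable_fun_def CL1_const)

lemma total_add:
  "separable_fun f \<Longrightarrow> separable_fun g \<Longrightarrow> total (\<lambda>k x. f k x + g k x) = total f + total g"
  by (simp add: separable_fun_def CL1_def sum.distrib)

lemma total_scale: "total (\<lambda>k x. r * f k x) = r * total f"
  by (simp add: sum_distrib_left)

lemma CL_iff: "h \<in> CL n X \<mu> \<longleftrightarrow> continuous_map (prod_top n X) euclideanreal h \<and>
   (\<exists>f. separable_fun f \<and> (\<forall>x\<in>topspace (prod_top n X). \<bar>h x\<bar> \<le> (\<Sum>k=1..n. f k (x k))))"
  by (auto simp: CL_def separable_fun_def)

text \<open>Replaces each \<open>f k\<close> by its absolute value. With nonnegative summands the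
  sum of two dominating functions also dominates a maximum.\<close>

lemma CL_dominating_nonneg:
  assumes "h \<in> CL n X \<mu>"
  obtains f where "separable_fun f" "\<And>k x. 0 \<le> f k x"
    "\<And>x. x \<in> topspace (prod_top n X) \<Longrightarrow> \<bar>h x\<bar> \<le> (\<Sum>k=1..n. f k (x k))"
proof -
  obtain f where f: "separable_fun f" "\<forall>x\<in>topspace (prod_top n X). \<bar>h x\<bar> \<le> (\<Sum>k=1..n. f k (x k))"
    using assms unfolding CL_iff by blast
  show thesis
  proof (rule that[of "\<lambda>k x. \<bar>f k x\<bar>"])
    show "separable_fun (\<lambda>k x. \<bar>f k x\<bar>)" using f(1) by (simp add: separable_fun_def CL1_abs)
    fix x assume "x \<in> topspace (prod_top n X)"
    with f(2) have "\<bar>h x\<bar> \<le> (\<Sum>k=1..n. f k (x k))" by blast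
    also have "\<dots> \<le> (\<Sum>k=1..n. \<bar>f k (x k)\<bar>)" by (intro sum_mono) simp
    finally show "\<bar>h x\<bar> \<le> (\<Sum>k=1..n. \<bar>f k (x k)\<bar>)" .
  qed simp
qed

lemma CL_add:
  assumes "g \<in> CL n X \<mu>" "h \<in> CL n X \<mu>" shows "(\<lambda>x. g x + h x) \<in> CL n X \<mu>"
proof -
  obtain f f' where f: "separable_fun f" "\<forall>x\<in>topspace (prod_top n X). \<bar>g x\<bar> \<le> (\<Sum>k=1..n. f k (x k))"
    and f': "separable_fun f'" "\<forall>x\<in>topspace (prod_top n X). \<bar>h x\<bar> \<le> (\<Sum>k=1..n. f' k (x k))"
    using assms unfolding CL_iff by blast
  have "\<bar>g x + h x\<bar> \<le> (\<Sum>k=1..n. f k (x k) + f' k (x k))" if "x \<in> topspace (prod_top n X)" for x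
    using f(2)[rule_format, OF that] f'(2)[rule_format, OF that] unfolding sum.distrib by linarith
  with separable_fun_add[OF f(1) f'(1)] show ?thesis
    using assms unfolding CL_iff by (blast intro: continuous_map_add)
qed

lemma CL_scale:
  assumes "h \<in> CL n X \<mu>" shows "(\<lambda>x. r * h x) \<in> CL n X \<mu>"
proof -
  obtain f where f: "separable_fun f" "\<forall>x\<in>topspace (prod_top n X). \<bar>h x\<bar> \<le> (\<Sum>k=1..n. f k (x k))"
    using assms unfolding CL_iff by blast
  have "\<bar>r * h x\<bar> \<le> (\<Sum>k=1..n. \<bar>r\<bar> * f k (x k))" if "x \<in> topspace (prod_top n X)" for x
    using f(2)[rule_format, OF that] unfolding sum_distrib_left[symmetric] abs_mult
    by (intro mult_left_mono) auto
  with separable_fun_scale[OF f(1)] show ?thesis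
    using assms unfolding CL_iff by (blast intro: continuous_map_real_mult_left)
qed

lemma CL_max:
  assumes "g \<in> CL n X \<mu>" "h \<in> CL n X \<mu>" shows "(\<lambda>x. max (g x) (h x)) \<in> CL n X \<mu>"
proof -
  obtain f where f: "separable_fun f" "\<And>k x. 0 \<le> f k x"
      "\<And>x. x \<in> topspace (prod_top n X) \<Longrightarrow> \<bar>g x\<bar> \<le> (\<Sum>k=1..n. f k (x k))"
    by (rule CL_dominating_nonneg[OF assms(1)]) (rule that)
  obtain f' where f': "separable_fun f'" "\<And>k x. 0 \<le> f' k x"
      "\<And>x. x \<in> topspace (prod_top n X) \<Longrightarrow> \<bar>h x\<bar> \<le> (\<Sum>k=1..n. f' k (x k))"
    by (rule CL_dominating_nonneg[OF assms(2)]) (rule that)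
  have "\<bar>max (g x) (h x)\<bar> \<le> (\<Sum>k=1..n. f k (x k) + f' k (x k))" if "x \<in> topspace (prod_top n X)" for x
  proof -
    have "0 \<le> (\<Sum>k=1..n. f k (x k))" "0 \<le> (\<Sum>k=1..n. f' k (x k))"
      by (intro sum_nonneg f(2) f'(2))+
    with f(3)[OF that] f'(3)[OF that] show ?thesis unfolding sum.distrib by linarith
  qed
  with separable_fun_add[OF f(1) f'(1)] show ?thesis
    using assms unfolding CL_iff by (blast intro: continuous_map_real_max)
qed

lemma CL_projection:
  assumes k: "k \<in> {1..n}" and f: "f \<in> CL1 (X k) (\<mu> k)"
  shows "(\<lambda>x. f (x k)) \<in> CL n X \<mu>"
  unfolding CL_iff
proof (intro conjI exI[of _ "(\<lambda>j x. 0)(k := \<lambda>x. \<bar>f x\<bar>)"] ballI)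
  have "continuous_map (prod_top n X) euclideanreal (f \<circ> (\<lambda>x. x k))"
    using f by (intro continuous_map_compose[OF continuous_map_product_projection[OF k]]) (simp add: CL1_def)
  then show "continuous_map (prod_top n X) euclideanreal (\<lambda>x. f (x k))" by (simp add: o_def)
  show "separable_fun ((\<lambda>j x. 0)(k := \<lambda>x. \<bar>f x\<bar>))"
    using f prob by (simp add: separable_fun_def CL1_abs CL1_const)
  fix x
  have "(\<Sum>j=1..n. ((\<lambda>j x. 0)(k := \<lambda>x. \<bar>f x\<bar>)) j (x j)) = (\<Sum>j=1..n. if j = k then \<bar>f (x k)\<bar> else 0)"
    by (intro sum.cong) auto
  then show "\<bar>f (x k)\<bar> \<le> (\<Sum>j=1..n. ((\<lambda>j x. 0)(k := \<lambda>x. \<bar>f x\<bar>)) j (x j))"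
    using k by simp
qed

lemma CL_bounded:
  assumes h: "continuous_map (prod_top n X) euclideanreal h"
    and b: "\<And>x. x \<in> topspace (prod_top n X) \<Longrightarrow> \<bar>h x\<bar> \<le> b"
  shows "h \<in> CL n X \<mu>"
  unfolding CL_iff
proof (intro conjI exI[of _ "\<lambda>k x. b / real n"] ballI h)
  show "separable_fun (\<lambda>k x. b / real n)" using prob by (simp add: separable_fun_def CL1_const)
  show "\<bar>h x\<bar> \<le> (\<Sum>k=1..n. b / real n)" if "x \<in> topspace (prod_top n X)" for x
    using b[OF that] n_pos by simp
qed

lemma CL_subspace: "fun_subspace (CL n X \<mu>)"
  unfolding fun_subspace_iff using CL_add CL_scale CL_bounded[of "\<lambda>x. 0" 0] by auto

lemma CL_separable_sum: "separable_fun f \<Longrightarrow> (\<lambda>x. \<Sum>k=1..n. f k (x k)) \<in> CL n X \<mu>"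
proof -
  assume f: "separable_fun f"
  have "(\<lambda>x. \<Sum>k\<in>K. f k (x k)) \<in> CL n X \<mu>" if "K \<subseteq> {1..n}" for K
    using finite_subset[OF that finite_atLeastAtMost] that
  proof (induction K rule: finite_induct)
    case empty
    then show ?case using CL_bounded[of "\<lambda>x. 0" 0] by simp
  next
    case (insert k K)
    then show ?case
      using CL_add[OF CL_projection[of k "f k"]] f by (simp add: separable_fun_def)
  qed
  then show ?thesis by blast
qed

section \<open>Integration against couplings\<close>

lemma coupling_projection:
  assumes \<pi>: "\<pi> \<in> couplings n X \<mu>" and k: "k \<in> {1..n}" and f: "f \<in> CL1 (X k) (\<mu> k)"
  shows "integrable \<pi> (\<lambda>x. f (x k))" "(\<integral>x. f (x k) \<partial>\<pi>) = (\<integral>x. f x \<partial>\<mu> k)"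
proof -
  have b: "sets \<pi> = sets (borel_of (prod_top n X))" and d: "distr \<pi> (borel_of (X k)) (\<lambda>x. x k) = \<mu> k"
    using \<pi> k by (auto simp: couplings_def borel_prob_def)
  have m: "(\<lambda>x. x k) \<in> \<pi> \<rightarrow>\<^sub>M borel_of (X k)"
    using continuous_map_measurable_borel_of[OF continuous_map_product_projection[OF k, of X]] b
    by (simp cong: measurable_cong_sets)
  have "f \<in> borel_measurable (borel_of (X k))"
    using continuous_map_measurable_borel_of[of "X k" euclideanreal f] f
    by (simp add: CL1_def borel_of_euclidean)
  then show "integrable \<pi> (\<lambda>x. f (x k))" "(\<integral>x. f (x k) \<partial>\<pi>) = (\<integral>x. f x \<partial>\<mu> k)"
    using integrable_distr_eq[OF m, of f] integral_distr[OF m, of f] f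
    by (simp_all add: d CL1_def)
qed

lemma coupling_integrable:
  assumes \<pi>: "\<pi> \<in> couplings n X \<mu>" and h: "h \<in> CL n X \<mu>"
  shows "integrable \<pi> h"
proof -
  have P: "borel_prob (prod_top n X) \<pi>" using \<pi> by (simp add: couplings_def)
  obtain f where f: "separable_fun f" "\<forall>x\<in>topspace (prod_top n X). \<bar>h x\<bar> \<le> (\<Sum>k=1..n. f k (x k))"
    using h unfolding CL_iff by blast
  show ?thesis
  proof (rule Bochner_Integration.integrable_bound)
    show "integrable \<pi> (\<lambda>x. \<Sum>k=1..n. f k (x k))"
      using f(1) by (intro Bochner_Integration.integrable_sum coupling_projection[OF \<pi>])
        (auto simp: separable_fun_def)
    show "h \<in> borel_measurable \<pi>"
      using h by (intro continuous_map_borel_measurable[OF P]) (simp add: CL_iff)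
    show "AE x in \<pi>. norm (h x) \<le> norm (\<Sum>k=1..n. f k (x k))"
      using f(2) by (intro AE_I2) (force simp: borel_prob_space[OF P])
  qed
qed

lemma coupling_total:
  assumes "\<pi> \<in> couplings n X \<mu>" "separable_fun f"
  shows "(\<integral>x. (\<Sum>k=1..n. f k (x k)) \<partial>\<pi>) = total f"
  using assms coupling_projection by (simp add: separable_fun_def)

text \<open>Off the compact boxes supplied by tightness, the decreasing sequence is dominated by a fixed
  separable function, whose large values contribute little; on them, Dini's argument applies.\<close>
lemma decreasing_separable_majorant:
  assumes h: "\<And>i::nat. h i \<in> CL n X \<mu>"
    and dec: "\<And>i x. x \<in> topspace (prod_top n X) \<Longrightarrow> h (Suc i) x \<le> h i x"
    and lim: "\<And>x. x \<in> topspace (prod_top n X) \<Longrightarrow> (\<lambda>i. h i x) \<longlonglongrightarrow> 0"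
    and e: "0 < e"
  obtains m f where "separable_fun f" "total f \<le> e"
    "\<And>x. x \<in> topspace (prod_top n X) \<Longrightarrow> h m x \<le> (\<Sum>k=1..n. f k (x k))"
proof -
  obtain f where f: "separable_fun f" "\<And>k x. 0 \<le> f k x"
      "\<And>x. x \<in> topspace (prod_top n X) \<Longrightarrow> \<bar>h 0 x\<bar> \<le> (\<Sum>k=1..n. f k (x k))"
    by (rule CL_dominating_nonneg[OF h]) (rule that)
  have n: "real n > 0" using n_pos by simp
  have "(\<lambda>R. total (\<lambda>k x. max 0 (f k x - real R))) \<longlonglongrightarrow> (\<Sum>k=1..n. 0)"
    using f(1) prob by (intro tendsto_sum CL1_excess_tendsto) (auto simp: separable_fun_def)
  then have "\<forall>\<^sub>F R in sequentially. total (\<lambda>k x. max 0 (f k x - real R)) < e / 3"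
    using e by (intro order_tendstoD(2)) auto
  then obtain R :: nat where R: "total (\<lambda>k x. max 0 (f k x - real R)) < e / 3"
    by (auto simp: eventually_sequentially)
  define G where "G k x = max 0 (f k x - real R)" for k x
  have G: "separable_fun G"
    using f(1) prob unfolding separable_fun_def G_def by (blast intro: CL1_excess)
  \<comment> \<open>\<open>n * R\<close> bounds the contribution of the values of \<open>f k\<close>
    up to level \<open>R\<close>; the 1 keeps \<open>B\<close> positive even for
    \<open>R = 0\<close>. The choice of \<open>\<eta>\<close> below makes
    \<open>B * (n * \<eta>)\<close> equal to \<open>e / 3\<close>, one of three shares of
    \<open>e\<close>.\<close>
  define B where "B = real n * real R + 1"
  have B: "B > 0" by (simp add: B_def add_nonneg_pos)
  define \<eta> where "\<eta> = e / (3 * B * real n)"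
  have \<eta>: "\<eta> > 0" using e B n by (simp add: \<eta>_def)
  have "\<forall>k\<in>{1..n}. \<exists>K. compactin (X k) K \<and> measure (\<mu> k) (topspace (X k) - K) \<le> \<eta>"
    using ulam_tightness[OF polish prob \<eta>] by metis
  then obtain K where K: "\<And>k. k \<in> {1..n} \<Longrightarrow> compactin (X k) (K k)"
    "\<And>k. k \<in> {1..n} \<Longrightarrow> measure (\<mu> k) (topspace (X k) - K k) \<le> \<eta>"
    by metis
  define U where "U m = {x \<in> topspace (prod_top n X). h m x \<in> {..<e / 3}}" for m
  have Uopen: "openin (prod_top n X) (U m)" for m
    unfolding U_def using h by (intro openin_continuous_map_preimage[of _ euclideanreal]) (auto simp: CL_iff)
  have decm: "h j x \<le> h i x" if "i \<le> j" "x \<in> topspace (prod_top n X)" for i j x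
    using that(1) lift_Suc_antimono_le[of "\<lambda>i. h i x"] dec[OF that(2)] by simp
  have Kcomp: "compactin (prod_top n X) (PiE {1..n} K)"
    using K(1) by (simp add: compactin_PiE)
  have "PiE {1..n} K \<subseteq> \<Union>(range U)"
  proof
    fix x assume "x \<in> PiE {1..n} K"
    then have x: "x \<in> topspace (prod_top n X)" using compactin_subset_topspace[OF Kcomp] by blast
    have "\<forall>\<^sub>F m in sequentially. h m x < e / 3"
      using lim[OF x] e by (intro order_tendstoD(2)) auto
    then obtain m where "h m x < e / 3" by (auto simp: eventually_sequentially)
    then show "x \<in> \<Union>(range U)" using x by (auto simp: U_def)
  qed
  then obtain J where J: "finite J" "PiE {1..n} K \<subseteq> \<Union>(U ` J)"
    using compactinD[OF Kcomp, of "range U"] Uopen finite_subset_image[of _ U UNIV] by (metis imageE)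
  \<comment> \<open>The sets \<open>U j\<close> grow with \<open>j\<close>, so the finite subcover
    is contained in a single \<open>U m\<close>.\<close>
  obtain m where m: "\<And>j. j \<in> J \<Longrightarrow> j \<le> m" using J(1) finite_nat_set_iff_bounded_le by metis
  have "U j \<subseteq> U m" if "j \<in> J" for j
    using decm[OF m[OF that]] by (force simp: U_def)
  then have "PiE {1..n} K \<subseteq> U m" using J(2) by blast
  \<comment> \<open>Passing to an open box leaves room between \<open>K k\<close> and the complement
    of \<open>V k\<close> for a continuous function of one coordinate.\<close>
  then obtain V where V: "\<And>k. k \<in> {1..n} \<Longrightarrow> openin (X k) (V k)" "\<And>k. k \<in> {1..n} \<Longrightarrow> K k \<subseteq> V k"
      "PiE {1..n} V \<subseteq> U m"
    using tube_product_topology[OF finite_atLeastAtMost Uopen K(1)] by metis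
  \<comment> \<open>The witness is one minus a bump: it vanishes on \<open>K k\<close>, is 1 off
    \<open>V k\<close>, and so integrates to at most the mass outside \<open>K k\<close>.\<close>
  have "\<forall>k\<in>{1..n}. \<exists>g. g \<in> CL1 (X k) (\<mu> k) \<and> (\<forall>x\<in>topspace (X k). 0 \<le> g x) \<and>
      (\<forall>x\<in>topspace (X k). x \<notin> V k \<longrightarrow> g x = 1) \<and> (\<integral>x. g x \<partial>\<mu> k) \<le> \<eta>"
  proof
    fix k assume k: "k \<in> {1..n}"
    interpret prob_space "\<mu> k" using prob[OF k] by (simp add: borel_prob_def)
    have Kcl: "closedin (X k) (K k)"
      using K(1)[OF k] metrizable_factor[OF k] compactin_imp_closedin metrizable_imp_Hausdorff_space by blast
    obtain b where b: "continuous_map (X k) euclideanreal b" "\<And>x. x \<in> topspace (X k) \<Longrightarrow> 0 \<le> b x \<and> b x \<le> 1"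
      "\<And>x. x \<in> K k \<Longrightarrow> b x = 1" "\<And>x. x \<in> topspace (X k) \<Longrightarrow> x \<notin> V k \<Longrightarrow> b x = (0::real)"
      using closedin_openin_bump[OF metrizable_factor[OF k] Kcl V(1,2)[OF k]] by metis
    have bC: "b \<in> CL1 (X k) (\<mu> k)" using b(2) by (intro bounded_CL1[OF prob[OF k] b(1), of 1]) auto
    have gC: "(\<lambda>x. 1 + (-1) * b x) \<in> CL1 (X k) (\<mu> k)"
      by (intro CL1_add CL1_scale CL1_const prob[OF k] bC)
    have mK: "topspace (X k) - K k \<in> sets (\<mu> k)"
      using prob[OF k] Kcl by (auto simp: borel_prob_def closedin_def intro: sets_borel_of_openin)
    have "(\<integral>x. 1 + (-1) * b x \<partial>\<mu> k) \<le> (\<integral>x. indicator (topspace (X k) - K k) x \<partial>\<mu> k)"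
    proof (rule integral_mono)
      show "integrable (\<mu> k) (indicator (topspace (X k) - K k) :: _ \<Rightarrow> real)"
        using mK by (simp add: integrable_indicator_iff less_top[symmetric])
    qed (use CL1_integrable[OF gC] b in \<open>auto simp: borel_prob_space[OF prob[OF k]] indicator_def\<close>)
    also have "\<dots> = measure (\<mu> k) (topspace (X k) - K k)" using mK by simp
    also have "\<dots> \<le> \<eta>" by (rule K(2)[OF k])
    finally show "\<exists>g. g \<in> CL1 (X k) (\<mu> k) \<and> (\<forall>x\<in>topspace (X k). 0 \<le> g x) \<and>
      (\<forall>x\<in>topspace (X k). x \<notin> V k \<longrightarrow> g x = 1) \<and> (\<integral>x. g x \<partial>\<mu> k) \<le> \<eta>"
      using gC b by (intro exI[of _ "\<lambda>x. 1 + (-1) * b x"]) auto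
  qed
  then obtain g where g: "\<And>k. k \<in> {1..n} \<Longrightarrow> g k \<in> CL1 (X k) (\<mu> k)"
      "\<And>k x. k \<in> {1..n} \<Longrightarrow> x \<in> topspace (X k) \<Longrightarrow> 0 \<le> g k x"
      "\<And>k x. k \<in> {1..n} \<Longrightarrow> x \<in> topspace (X k) \<Longrightarrow> x \<notin> V k \<Longrightarrow> g k x = 1"
      "\<And>k. k \<in> {1..n} \<Longrightarrow> (\<integral>x. g k x \<partial>\<mu> k) \<le> \<eta>"
    by metis
  have gs: "separable_fun g" using g(1) by (simp add: separable_fun_def)
  have cs: "separable_fun (\<lambda>k x. e / 3 / real n)" using prob by (simp add: separable_fun_def CL1_const)
  \<comment> \<open>The three terms pay, in this order, for points in the open box, for points
    outside it, and for the excess of the dominating function over \<open>R\<close>.\<close>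
  define F where "F k x = e / 3 / real n + (B * g k x + G k x)" for k x
  show thesis
  proof (rule that[of F m])
    show "separable_fun F"
      unfolding F_def by (intro separable_fun_add separable_fun_scale gs cs G)
    have "total F = total (\<lambda>k x. e / 3 / real n) + (B * total g + total G)"
      using total_add[OF cs separable_fun_add[OF separable_fun_scale[OF gs, of B] G]]
        total_add[OF separable_fun_scale[OF gs, of B] G] total_scale[of B g]
      by (simp only: F_def)
    also have "total (\<lambda>k x. e / 3 / real n) = (\<Sum>k=1..n. e / 3 / real n)"
      using prob by (intro sum.cong) (auto simp: borel_prob_def prob_space.prob_space)
    also have "\<dots> = e / 3" using n by simp
    also have "total g \<le> (\<Sum>k=1..n. \<eta>)" by (intro sum_mono g(4)) 
    then have "B * total g \<le> B * (real n * \<eta>)" using B by (intro mult_left_mono) auto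
    also have "B * (real n * \<eta>) = e / 3" using B n by (simp add: \<eta>_def field_simps)
    finally show "total F \<le> e" using R by (simp add: G_def)
    fix x assume x: "x \<in> topspace (prod_top n X)"
    then have xk: "x k \<in> topspace (X k)" if "k \<in> {1..n}" for k
      using that by (auto simp: PiE_iff)
    have sumF: "(\<Sum>k=1..n. F k (x k)) = e / 3 + B * (\<Sum>k=1..n. g k (x k)) + (\<Sum>k=1..n. G k (x k))"
      using n by (simp add: F_def sum.distrib sum_distrib_left)
    have g0: "0 \<le> (\<Sum>k=1..n. g k (x k))" by (intro sum_nonneg g(2) xk)
    have G0: "0 \<le> (\<Sum>k=1..n. G k (x k))" by (intro sum_nonneg) (simp add: G_def)
    show "h m x \<le> (\<Sum>k=1..n. F k (x k))"
    proof (cases "\<forall>k\<in>{1..n}. x k \<in> V k")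
      case True
      then have "x \<in> PiE {1..n} V" using x by (auto simp: PiE_iff)
      then have "h m x < e / 3" using V(3) by (auto simp: U_def)
      then show ?thesis using g0 G0 B mult_nonneg_nonneg[of B "\<Sum>k=1..n. g k (x k)"] unfolding sumF by linarith
    next
      case False
      then obtain k where k: "k \<in> {1..n}" "x k \<notin> V k" by blast
      have "1 = g k (x k)" using g(3)[OF k(1) xk[OF k(1)] k(2)] by simp
      also have "\<dots> \<le> (\<Sum>k=1..n. g k (x k))"
        using k(1) g(2) xk by (intro member_le_sum) auto
      finally have "B \<le> B * (\<Sum>k=1..n. g k (x k))" using B by simp
      moreover have "h m x \<le> (\<Sum>k=1..n. f k (x k))"
        using decm[of 0 m x] f(3)[OF x] x by force
      moreover have "(\<Sum>k=1..n. f k (x k)) \<le> (\<Sum>k=1..n. real R + G k (x k))"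
        by (intro sum_mono) (simp add: G_def)
      moreover have "(\<Sum>k=1..n. real R + G k (x k)) = real n * real R + (\<Sum>k=1..n. G k (x k))"
        by (simp add: sum.distrib)
      ultimately show ?thesis using e unfolding sumF B_def by linarith
    qed
  qed
qed

end

section \<open>The price functional and strong duality\<close>

locale constrained_marginals = marginals +
  fixes W :: "((nat \<Rightarrow> 'a) \<Rightarrow> real) set"
  assumes W_subspace: "fun_subspace W" and W_CL: "W \<subseteq> CL n X \<mu>"
begin

definition majorant_values :: "((nat \<Rightarrow> 'a) \<Rightarrow> real) \<Rightarrow> real set" where
  "majorant_values h = {total f | f \<omega>. separable_fun f \<and> \<omega> \<in> W \<and>
    (\<forall>x\<in>topspace (prod_top n X). h x \<le> (\<Sum>k=1..n. f k (x k)) + \<omega> x)}"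

text \<open>This is the \<open>p\<close> of the overview. The real \<open>Inf\<close> carries
  meaning only for nonempty sets bounded below, so facts about it are proved where the zero function
  has no negative majorant value.\<close>

definition upper_price :: "((nat \<Rightarrow> 'a) \<Rightarrow> real) \<Rightarrow> real" where
  "upper_price h = Inf (majorant_values h)"

lemma W_zero: "(\<lambda>x. 0) \<in> W"
  and W_add: "w \<in> W \<Longrightarrow> w' \<in> W \<Longrightarrow> (\<lambda>x. w x + w' x) \<in> W"
  and W_scale: "w \<in> W \<Longrightarrow> (\<lambda>x. r * w x) \<in> W"
  using W_subspace unfolding fun_subspace_iff by blast+

lemma majorant_valuesI:
  "separable_fun f \<Longrightarrow> \<omega> \<in> W \<Longrightarrow>
    (\<And>x. x \<in> topspace (prod_top n X) \<Longrightarrow> h x \<le> (\<Sum>k=1..n. f k (x k)) + \<omega> x) \<Longrightarrow>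
    total f \<in> majorant_values h"
  unfolding majorant_values_def by blast

lemma majorant_valuesE:
  assumes "s \<in> majorant_values h"
  obtains f \<omega> where "separable_fun f" "\<omega> \<in> W" "s = total f"
    "\<And>x. x \<in> topspace (prod_top n X) \<Longrightarrow> h x \<le> (\<Sum>k=1..n. f k (x k)) + \<omega> x"
  using assms unfolding majorant_values_def by blast

text \<open>A majorant taken from \<open>W\<close> alone costs nothing. Positivity of
  \<open>L\<close> (with \<open>w = 0\<close>) and its vanishing on \<open>W\<close> both rest on
  this.\<close>

lemma zero_in_majorant_values:
  assumes "w \<in> W" "\<And>x. x \<in> topspace (prod_top n X) \<Longrightarrow> h x \<le> w x"
  shows "0 \<in> majorant_values h"
  using majorant_valuesI[OF separable_fun_zero assms(1), of h] assms(2) by simp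

lemma majorant_values_add:
  assumes "s \<in> majorant_values g" "t \<in> majorant_values h"
  shows "s + t \<in> majorant_values (\<lambda>x. g x + h x)"
proof -
  obtain f \<omega> where 1: "separable_fun f" "\<omega> \<in> W" "s = total f"
    "\<And>x. x \<in> topspace (prod_top n X) \<Longrightarrow> g x \<le> (\<Sum>k=1..n. f k (x k)) + \<omega> x"
    by (rule majorant_valuesE[OF assms(1)]) (rule that)
  obtain f' \<omega>' where 2: "separable_fun f'" "\<omega>' \<in> W" "t = total f'"
    "\<And>x. x \<in> topspace (prod_top n X) \<Longrightarrow> h x \<le> (\<Sum>k=1..n. f' k (x k)) + \<omega>' x"
    by (rule majorant_valuesE[OF assms(2)]) (rule that)
  have "total (\<lambda>k x. f k x + f' k x) \<in> majorant_values (\<lambda>x. g x + h x)"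
  proof (rule majorant_valuesI)
    show "g x + h x \<le> (\<Sum>k=1..n. f k (x k) + f' k (x k)) + (\<omega> x + \<omega>' x)"
      if "x \<in> topspace (prod_top n X)" for x
      using 1(4)[OF that] 2(4)[OF that] unfolding sum.distrib by linarith
  qed (intro separable_fun_add W_add 1 2)+
  then show ?thesis unfolding 1(3) 2(3) total_add[OF 1(1) 2(1)] .
qed

lemma majorant_values_scale:
  assumes "s \<in> majorant_values h" "0 \<le> r"
  shows "r * s \<in> majorant_values (\<lambda>x. r * h x)"
proof -
  obtain f \<omega> where 1: "separable_fun f" "\<omega> \<in> W" "s = total f"
    "\<And>x. x \<in> topspace (prod_top n X) \<Longrightarrow> h x \<le> (\<Sum>k=1..n. f k (x k)) + \<omega> x"
    by (rule majorant_valuesE[OF assms(1)]) (rule that)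
  have "total (\<lambda>k x. r * f k x) \<in> majorant_values (\<lambda>x. r * h x)"
  proof (rule majorant_valuesI)
    show "r * h x \<le> (\<Sum>k=1..n. r * f k (x k)) + r * \<omega> x" if "x \<in> topspace (prod_top n X)" for x
      using mult_left_mono[OF 1(4)[OF that] assms(2)] unfolding sum_distrib_left[symmetric] distrib_left .
  qed (intro separable_fun_scale W_scale 1)+
  then show ?thesis unfolding 1(3) total_scale .
qed

lemma majorant_values_nonempty:
  assumes "h \<in> CL n X \<mu>" obtains s where "s \<in> majorant_values h"
proof -
  obtain f where f: "separable_fun f" "\<And>k x. 0 \<le> f k x"
      "\<And>x. x \<in> topspace (prod_top n X) \<Longrightarrow> \<bar>h x\<bar> \<le> (\<Sum>k=1..n. f k (x k))"
    by (rule CL_dominating_nonneg[OF assms]) (rule that)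
  have "total f \<in> majorant_values h"
    using f(3) by (intro majorant_valuesI[OF f(1) W_zero]) (simp add: abs_le_iff)
  then show thesis by (rule that)
qed

text \<open>Weak duality: under every admissible coupling \<open>\<omega>\<close> integrates to 0
  and the separable part to \<open>total f\<close>.\<close>

lemma integral_le_majorant_value:
  assumes \<pi>: "\<pi> \<in> couplings_on n X \<mu> W" and h: "h \<in> CL n X \<mu>" and s: "s \<in> majorant_values h"
  shows "(\<integral>x. h x \<partial>\<pi>) \<le> s"
proof -
  have \<pi>': "\<pi> \<in> couplings n X \<mu>" "\<And>w. w \<in> W \<Longrightarrow> (\<integral>x. w x \<partial>\<pi>) = 0"
    using \<pi> by (auto simp: couplings_on_def)
  then have P: "borel_prob (prod_top n X) \<pi>" by (simp add: couplings_def)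
  obtain f \<omega> where 1: "separable_fun f" "\<omega> \<in> W" "s = total f"
    "\<And>x. x \<in> topspace (prod_top n X) \<Longrightarrow> h x \<le> (\<Sum>k=1..n. f k (x k)) + \<omega> x"
    by (rule majorant_valuesE[OF s]) (rule that)
  have int: "integrable \<pi> (\<lambda>x. \<Sum>k=1..n. f k (x k))" "integrable \<pi> \<omega>"
    using coupling_integrable[OF \<pi>'(1)] CL_separable_sum[OF 1(1)] W_CL 1(2) by blast+
  have "(\<integral>x. h x \<partial>\<pi>) \<le> (\<integral>x. (\<Sum>k=1..n. f k (x k)) + \<omega> x \<partial>\<pi>)"
    using 1(4) int by (intro integral_mono coupling_integrable[OF \<pi>'(1) h] Bochner_Integration.integrable_add)
      (auto simp: borel_prob_space[OF P])
  also have "\<dots> = total f + 0"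
    using Bochner_Integration.integral_add[OF int] coupling_total[OF \<pi>'(1) 1(1)] \<pi>'(2)[OF 1(2)] by simp
  finally show ?thesis using 1(3) by simp
qed

text \<open>A value for \<open>h\<close> plus a value for \<open>- h\<close> is a value for the zero
  function, hence nonnegative. This bounds \<open>majorant_values h\<close> below, and sublinearity
  is inherited from adding and scaling majorants.\<close>

lemma upper_price_sublinear:
  assumes nonneg: "\<And>s. s \<in> majorant_values (\<lambda>x. 0) \<Longrightarrow> 0 \<le> s"
  shows "sublinear_on (\<lambda>r h x. r * h x) (CL n X \<mu>) upper_price"
    "\<And>h s. h \<in> CL n X \<mu> \<Longrightarrow> s \<in> majorant_values h \<Longrightarrow> upper_price h \<le> s"
proof -
  have neg: "(\<lambda>x. - h x) \<in> CL n X \<mu>" if "h \<in> CL n X \<mu>" for h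
    using CL_scale[OF that, of "-1"] by simp
  have bdd: "bdd_below (majorant_values h)" if h: "h \<in> CL n X \<mu>" for h
  proof -
    obtain t where t: "t \<in> majorant_values (\<lambda>x. - h x)"
      by (rule majorant_values_nonempty[OF neg[OF h]]) (rule that)
    have "- t \<le> s" if "s \<in> majorant_values h" for s
      using nonneg majorant_values_add[OF that t] by fastforce
    then show ?thesis by (rule bdd_belowI)
  qed
  show le: "upper_price h \<le> s" if "h \<in> CL n X \<mu>" "s \<in> majorant_values h" for h s
    unfolding upper_price_def by (intro cInf_lower that bdd)
  have ge: "r \<le> upper_price h" if "h \<in> CL n X \<mu>" "\<And>s. s \<in> majorant_values h \<Longrightarrow> r \<le> s" for h r
    unfolding upper_price_def
    using that majorant_values_nonempty[OF that(1)] by (intro cInf_greatest) auto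
  have "upper_price (\<lambda>x. g x + h x) \<le> upper_price g + upper_price h"
    if gh: "g \<in> CL n X \<mu>" "h \<in> CL n X \<mu>" for g h
  proof -
    have "upper_price (\<lambda>x. g x + h x) - s \<le> upper_price h" if "s \<in> majorant_values g" for s
      using le[OF CL_add[OF gh] majorant_values_add[OF that]] by (intro ge gh) (simp add: algebra_simps)
    then have "upper_price (\<lambda>x. g x + h x) - upper_price h \<le> upper_price g"
      by (intro ge gh) (simp add: algebra_simps)
    then show ?thesis by simp
  qed
  moreover have "upper_price (\<lambda>x. r * h x) = r * upper_price h"
    if r: "r \<ge> 0" and h: "h \<in> CL n X \<mu>" for r h
  proof (cases "r = 0")
    case True
    have "0 \<in> majorant_values (\<lambda>x. 0)" by (rule zero_in_majorant_values[OF W_zero]) simp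
    moreover have "(\<lambda>x. 0) \<in> CL n X \<mu>" using CL_scale[OF h, of 0] by simp
    ultimately have "upper_price (\<lambda>x. 0) = 0"
      using nonneg by (intro antisym le ge) auto
    then show ?thesis using True by simp
  next
    case False
    with r have r: "r > 0" by simp
    show ?thesis
    proof (rule antisym)
      have "upper_price (\<lambda>x. r * h x) / r \<le> upper_price h"
      proof (rule ge[OF h])
        fix s assume "s \<in> majorant_values h"
        then have "upper_price (\<lambda>x. r * h x) \<le> r * s"
          using r by (intro le CL_scale h majorant_values_scale) auto
        then show "upper_price (\<lambda>x. r * h x) / r \<le> s" using r by (simp add: field_simps)
      qed
      then show "upper_price (\<lambda>x. r * h x) \<le> r * upper_price h" using r by (simp add: field_simps)
      show "r * upper_price h \<le> upper_price (\<lambda>x. r * h x)"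
      proof (rule ge[OF CL_scale[OF h]])
        fix s assume "s \<in> majorant_values (\<lambda>x. r * h x)"
        then have "(1 / r) * s \<in> majorant_values h"
          using majorant_values_scale[of s "\<lambda>x. r * h x" "1 / r"] r by simp
        then have "upper_price h \<le> (1 / r) * s" by (intro le h)
        then show "r * upper_price h \<le> s" using r by (simp add: field_simps)
      qed
    qed
  qed
  ultimately show "sublinear_on (\<lambda>r h x. r * h x) (CL n X \<mu>) upper_price"
    by (simp add: sublinear_on_def plus_fun_def)
qed

text \<open>Every property required of the measure comes from testing \<open>L_le\<close> with a
  suitable majorant. Equalities arise by using a function and its negative.\<close>

lemma coupling_of_functional:
  assumes L_add: "\<And>g h. g \<in> CL n X \<mu> \<Longrightarrow> h \<in> CL n X \<mu> \<Longrightarrow> L (\<lambda>x. g x + h x) = L g + L h"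
    and L_scale: "\<And>r h. h \<in> CL n X \<mu> \<Longrightarrow> L (\<lambda>x. r * h x) = r * L h"
    and L_le: "\<And>h s. h \<in> CL n X \<mu> \<Longrightarrow> s \<in> majorant_values h \<Longrightarrow> L h \<le> s"
  obtains \<pi> where "\<pi> \<in> couplings_on n X \<mu> W" "\<And>h. h \<in> CL n X \<mu> \<Longrightarrow> (\<integral>x. h x \<partial>\<pi>) = L h"
proof -
  have L_neg: "L (\<lambda>x. - h x) = - L h" if "h \<in> CL n X \<mu>" for h
    using L_scale[OF that, of "-1"] by simp
  have neg: "(\<lambda>x. - h x) \<in> CL n X \<mu>" if "h \<in> CL n X \<mu>" for h
    using CL_scale[OF that, of "-1"] by simp
  have L_nonneg: "0 \<le> L h" if "h \<in> CL n X \<mu>" "\<And>x. x \<in> topspace (prod_top n X) \<Longrightarrow> 0 \<le> h x" for h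
    using L_le[OF neg[OF that(1)] zero_in_majorant_values[OF W_zero]] that L_neg by simp
  have L_W: "L w = 0" if w: "w \<in> W" for w
  proof -
    have "w \<in> CL n X \<mu>" using w W_CL by blast
    moreover have "(\<lambda>x. - w x) \<in> W" using W_scale[OF w, of "-1"] by simp
    ultimately show ?thesis
      using L_le[of w 0] L_le[of "\<lambda>x. - w x" 0] zero_in_majorant_values[OF w]
        zero_in_majorant_values[of "\<lambda>x. - w x" "\<lambda>x. - w x"] neg L_neg by fastforce
  qed
  have L_separable: "L h \<le> total f"
    if "h \<in> CL n X \<mu>" "separable_fun f" "\<And>x. x \<in> topspace (prod_top n X) \<Longrightarrow> h x \<le> (\<Sum>k=1..n. f k (x k))" for h f
    using that by (intro L_le majorant_valuesI[OF _ W_zero]) auto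
  \<comment> \<open>The tuple with \<open>f\<close> in position \<open>k\<close> and 0 elsewhere
    majorizes \<open>f (x k)\<close> exactly. Applied to \<open>- f\<close> too, the bound becomes
    the equality \<open>L_proj\<close>.\<close>
  have L_proj_le: "L (\<lambda>x. f (x k)) \<le> (\<integral>x. f x \<partial>\<mu> k)" if k: "k \<in> {1..n}" and f: "f \<in> CL1 (X k) (\<mu> k)" for k f
  proof -
    define F where "F = (\<lambda>j x. if j = k then f x else 0 :: real)"
    have "separable_fun F"
      unfolding separable_fun_def
    proof
      show "F j \<in> CL1 (X j) (\<mu> j)" if "j \<in> {1..n}" for j
        using f CL1_const[OF prob[OF that], of 0] by (cases "j = k") (simp_all add: F_def)
    qed
    moreover have "(\<Sum>j=1..n. F j (x j)) = f (x k)" for x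
    proof -
      have "(\<Sum>j=1..n. F j (x j)) = (\<Sum>j=1..n. if j = k then f (x k) else 0)"
        by (intro sum.cong) (auto simp: F_def)
      then show ?thesis using k by simp
    qed
    moreover have "total F = (\<integral>x. f x \<partial>\<mu> k)"
    proof -
      have "total F = (\<Sum>j=1..n. if j = k then \<integral>x. f x \<partial>\<mu> k else 0)"
        by (intro sum.cong) (auto simp: F_def)
      then show ?thesis using k by simp
    qed
    ultimately show ?thesis using L_separable[OF CL_projection[OF k f], of F] by simp
  qed
  have L_proj: "L (\<lambda>x. f (x k)) = (\<integral>x. f x \<partial>\<mu> k)" if k: "k \<in> {1..n}" and f: "f \<in> CL1 (X k) (\<mu> k)" for k f
    using L_proj_le[OF k f] L_proj_le[OF k CL1_scale[OF f, of "-1"]] L_neg[OF CL_projection[OF k f]]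
    by simp
  have cont: "(\<lambda>i. L (h i)) \<longlonglongrightarrow> 0"
    if h: "\<And>i::nat. h i \<in> CL n X \<mu>" and dec: "\<And>i x. x \<in> topspace (prod_top n X) \<Longrightarrow> h (Suc i) x \<le> h i x"
      and lim: "\<And>x. x \<in> topspace (prod_top n X) \<Longrightarrow> (\<lambda>i. h i x) \<longlonglongrightarrow> 0" for h
  proof (rule LIMSEQ_I)
    fix e :: real assume e: "0 < e"
    have decm: "h j x \<le> h i x" if "i \<le> j" "x \<in> topspace (prod_top n X)" for i j x
      using that(1) lift_Suc_antimono_le[of "\<lambda>i. h i x"] dec[OF that(2)] by simp
    have h0: "0 \<le> h i x" if "x \<in> topspace (prod_top n X)" for i x
      using decm[OF _ that] by (intro LIMSEQ_le_const2[OF lim[OF that]]) auto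
    obtain m f where f: "separable_fun f" "total f \<le> e / 2"
      "\<And>x. x \<in> topspace (prod_top n X) \<Longrightarrow> h m x \<le> (\<Sum>k=1..n. f k (x k))"
      by (rule decreasing_separable_majorant[OF h dec lim, of "e / 2"]) (use e in \<open>auto intro: that\<close>)
    have "norm (L (h i) - 0) < e" if "m \<le> i" for i
    proof -
      have "L (h i) \<le> total f"
        using decm[OF that] f(3) by (intro L_separable h f(1)) (blast intro: order_trans)
      moreover have "0 \<le> L (h i)" by (intro L_nonneg h h0)
      ultimately show ?thesis using f(2) e by simp
    qed
    then show "\<exists>m. \<forall>i\<ge>m. norm (L (h i) - 0) < e" by blast
  qed
  have one: "(\<lambda>x. 1) \<in> CL n X \<mu>" by (rule CL_bounded[of _ 1]) auto
  interpret D: daniell_functional "topspace (prod_top n X)" "CL n X \<mu>" L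
    by unfold_locales (fact CL_add CL_scale one CL_max L_add L_scale L_nonneg cont)+
  define \<pi> where "\<pi> = D.representing"
  have int: "(\<integral>x. h x \<partial>\<pi>) = L h" if "h \<in> CL n X \<mu>" for h
    using D.integral_representing(2)[OF that] by (simp add: \<pi>_def)
  have space: "space \<pi> = topspace (prod_top n X)" unfolding \<pi>_def by (rule D.space_representing)
  \<comment> \<open>Superlevel sets of continuous functions are open. Conversely an open set is a
    countable union of closed sets, each enclosed in a positivity set of a bounded continuous
    function vanishing off \<open>U\<close>.\<close>
  have sets: "sets \<pi> = sets (borel_of (prod_top n X))"
    unfolding \<pi>_def D.sets_representing sets_borel_of
  proof (rule sigma_sets_eqI)
    fix A assume "A \<in> {{x \<in> topspace (prod_top n X). a < h x} |h a. h \<in> CL n X \<mu>}"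
    then obtain h a where A: "A = {x \<in> topspace (prod_top n X). h x \<in> {a<..}}" "h \<in> CL n X \<mu>" by auto
    have "openin (prod_top n X) A"
      unfolding A(1) using A(2) by (intro openin_continuous_map_preimage[of _ euclideanreal]) (auto simp: CL_iff)
    then show "A \<in> sigma_sets (topspace (prod_top n X)) {U. openin (prod_top n X) U}" by (auto intro: sigma_sets.Basic)
  next
    fix U assume "U \<in> {U. openin (prod_top n X) U}"
    then have U: "openin (prod_top n X) U" by simp
    obtain C where C: "\<And>i::nat. closedin (prod_top n X) (C i)" "\<Union>(range C) = U"
      using open_imp_fsigma_in[OF metrizable_prod U] unfolding fsigma_in_ascending by blast
    have "\<exists>f. f \<in> CL n X \<mu> \<and> C i \<subseteq> {x \<in> topspace (prod_top n X). 0 < f x} \<and>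
        {x \<in> topspace (prod_top n X). 0 < f x} \<subseteq> U" for i
    proof -
      have "C i \<subseteq> U" using C(2) by blast
      then obtain f where f: "continuous_map (prod_top n X) euclideanreal f"
        "\<And>x. x \<in> topspace (prod_top n X) \<Longrightarrow> 0 \<le> f x \<and> f x \<le> 1"
        "\<And>x. x \<in> C i \<Longrightarrow> f x = 1" "\<And>x. x \<in> topspace (prod_top n X) \<Longrightarrow> x \<notin> U \<Longrightarrow> f x = (0::real)"
        by (rule closedin_openin_bump[OF metrizable_prod C(1) U]) (rule that)
      have "f \<in> CL n X \<mu>" using f(2) by (intro CL_bounded[OF f(1), of 1]) auto
      moreover have "C i \<subseteq> {x \<in> topspace (prod_top n X). 0 < f x}"
        using f(3) closedin_subset[OF C(1)] by fastforce
      moreover have "{x \<in> topspace (prod_top n X). 0 < f x} \<subseteq> U"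
        using f(4) by fastforce
      ultimately show ?thesis by blast
    qed
    then have "\<exists>f. \<forall>i. f i \<in> CL n X \<mu> \<and> C i \<subseteq> {x \<in> topspace (prod_top n X). 0 < f i x} \<and>
        {x \<in> topspace (prod_top n X). 0 < f i x} \<subseteq> U"
      by (intro choice allI)
    then obtain f where f: "\<And>i. f i \<in> CL n X \<mu>"
        "\<And>i. C i \<subseteq> {x \<in> topspace (prod_top n X). 0 < f i x}"
        "\<And>i. {x \<in> topspace (prod_top n X). 0 < f i x} \<subseteq> U"
      by blast
    have "U = (\<Union>i. {x \<in> topspace (prod_top n X). 0 < f i x})"
      using C(2) f(2,3) by blast
    moreover have "{x \<in> topspace (prod_top n X). 0 < f i x} \<in> sets \<pi>" for i
      unfolding \<pi>_def D.sets_representing using f(1) by (blast intro: sigma_sets.Basic)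
    ultimately have "U \<in> sets \<pi>" by auto
    then show "U \<in> sigma_sets (topspace (prod_top n X))
        {{x \<in> topspace (prod_top n X). a < h x} |h a. h \<in> CL n X \<mu>}"
      unfolding \<pi>_def D.sets_representing .
  qed
  \<comment> \<open>The constant 1 is read as a function of the first coordinate, which exists since
    \<open>n \<ge> 1\<close>.\<close>
  have L1: "L (\<lambda>x. 1) = 1"
  proof -
    have k: "1 \<in> {1..n}" using n_pos by simp
    interpret prob_space "\<mu> 1" using prob[OF k] by (simp add: borel_prob_def)
    show ?thesis using L_proj[OF k CL1_const[OF prob[OF k], of 1]] prob_space by simp
  qed
  have "emeasure \<pi> (space \<pi>) = 1"
    unfolding space unfolding \<pi>_def D.emeasure_representing_space L1 by simp
  then have P: "borel_prob (prod_top n X) \<pi>"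
    unfolding borel_prob_def using sets by (blast intro: prob_spaceI)
  have marg: "distr \<pi> (borel_of (X k)) (\<lambda>x. x k) = \<mu> k" if k: "k \<in> {1..n}" for k
  proof (rule borel_prob_eqI[OF metrizable_factor[OF k] _ prob[OF k]])
    interpret prob_space \<pi> using P by (simp add: borel_prob_def)
    have m: "(\<lambda>x. x k) \<in> \<pi> \<rightarrow>\<^sub>M borel_of (X k)"
      using continuous_map_measurable_borel_of[OF continuous_map_product_projection[OF k, of X]] sets
      by (simp cong: measurable_cong_sets)
    then show "borel_prob (X k) (distr \<pi> (borel_of (X k)) (\<lambda>x. x k))"
      by (simp add: borel_prob_def prob_space_distr)
    fix f assume f: "continuous_map (X k) euclideanreal f"
      and f01: "\<And>x. x \<in> topspace (X k) \<Longrightarrow> 0 \<le> f x \<and> f x \<le> 1"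
    have "f \<in> CL1 (X k) (\<mu> k)"
      using f01 by (intro bounded_CL1[OF prob[OF k] f, of 1]) auto
    moreover have "f \<in> borel_measurable (borel_of (X k))"
      using continuous_map_measurable_borel_of[OF f] by (simp add: borel_of_euclidean)
    ultimately show "(\<integral>x. f x \<partial>distr \<pi> (borel_of (X k)) (\<lambda>x. x k)) = (\<integral>x. f x \<partial>\<mu> k)"
      using integral_distr[OF m, of f] int[OF CL_projection[OF k, of f]] L_proj[OF k, of f] by simp
  qed
  have "\<pi> \<in> couplings_on n X \<mu> W"
    using P marg int L_W W_CL by (auto simp: couplings_on_def couplings_def)
  then show thesis using int by (rule that)
qed

text \<open>Negating \<open>f\<close> and \<open>\<omega>\<close> turns minorants of
  \<open>c\<close> into majorants of \<open>- c\<close>; \<open>W\<close> is closed under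
  negation.\<close>

lemma dual_set_eq:
  "{ereal (\<Sum>k=1..n. \<integral>x. f k x \<partial>\<mu> k) | f \<omega>.
      (\<forall>k\<in>{1..n}. f k \<in> CL1 (X k) (\<mu> k)) \<and> \<omega> \<in> W \<and>
      (\<forall>x\<in>topspace (prod_top n X). (\<Sum>k=1..n. f k (x k)) + \<omega> x \<le> c x)} =
    (\<lambda>s. ereal (- s)) ` majorant_values (\<lambda>x. - c x)" (is "?D = ?R")
proof (intro equalityI subsetI)
  fix y assume "y \<in> ?D"
  then obtain f \<omega> where y: "y = ereal (total f)" and f: "separable_fun f" and \<omega>: "\<omega> \<in> W"
    and le: "\<And>x. x \<in> topspace (prod_top n X) \<Longrightarrow> (\<Sum>k=1..n. f k (x k)) + \<omega> x \<le> c x"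
    unfolding separable_fun_def by blast
  have "total (\<lambda>k x. (-1) * f k x) \<in> majorant_values (\<lambda>x. - c x)"
  proof (rule majorant_valuesI[OF separable_fun_scale[OF f] W_scale[OF \<omega>]])
    show "- c x \<le> (\<Sum>k=1..n. (-1) * f k (x k)) + (-1) * \<omega> x" if "x \<in> topspace (prod_top n X)" for x
      using le[OF that] unfolding sum_distrib_left[symmetric] by linarith
  qed
  then have "(-1) * total f \<in> majorant_values (\<lambda>x. - c x)" unfolding total_scale .
  then show "y \<in> ?R" unfolding y by (intro image_eqI[of _ _ "(-1) * total f"]) auto
next
  fix y assume "y \<in> ?R"
  then obtain s where y: "y = ereal (- s)" and s: "s \<in> majorant_values (\<lambda>x. - c x)" by blast
  obtain f \<omega> where f: "separable_fun f" "\<omega> \<in> W" "s = total f"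
    "\<And>x. x \<in> topspace (prod_top n X) \<Longrightarrow> - c x \<le> (\<Sum>k=1..n. f k (x k)) + \<omega> x"
    by (rule majorant_valuesE[OF s]) (rule that)
  have "(\<Sum>k=1..n. (-1) * f k (x k)) + (-1) * \<omega> x \<le> c x" if "x \<in> topspace (prod_top n X)" for x
    using f(4)[OF that] unfolding sum_distrib_left[symmetric] by linarith
  moreover have "y = ereal (total (\<lambda>k x. (-1) * f k x))" unfolding total_scale y f(3) by simp
  ultimately show "y \<in> ?D"
    using separable_fun_scale[OF f(1), of "-1", unfolded separable_fun_def] W_scale[OF f(2), of "-1"]
    by (intro CollectI exI[of _ "\<lambda>k x. (-1) * f k x"] exI[of _ "\<lambda>x. (-1) * \<omega> x"] conjI ballI) blast+
qed

lemma duality: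
  assumes c: "c \<in> CL n X \<mu>"
  shows "(INF \<pi>\<in>couplings_on n X \<mu> W. ereal (\<integral>x. c x \<partial>\<pi>)) =
    (SUP s\<in>majorant_values (\<lambda>x. - c x). ereal (- s))" (is "?I = ?S")
proof (rule antisym)
  have nc: "(\<lambda>x. - c x) \<in> CL n X \<mu>" using CL_scale[OF c, of "-1"] by simp
  show "?S \<le> ?I"
  proof (intro SUP_least INF_greatest)
    fix s \<pi> assume "s \<in> majorant_values (\<lambda>x. - c x)" "\<pi> \<in> couplings_on n X \<mu> W"
    from integral_le_majorant_value[OF this(2) nc this(1)]
    show "ereal (- s) \<le> ereal (\<integral>x. c x \<partial>\<pi>)" by simp
  qed
  show "?I \<le> ?S"
  proof (cases "\<exists>s\<in>majorant_values (\<lambda>x. 0). s < 0")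
    case True
    then obtain s where s: "s \<in> majorant_values (\<lambda>x. 0)" "s < 0" by blast
    obtain t where t: "t \<in> majorant_values (\<lambda>x. - c x)"
      by (rule majorant_values_nonempty[OF nc]) (rule that)
    \<comment> \<open>Adding the negative value \<open>s\<close> to a fixed value \<open>t\<close>
      sufficiently often pushes majorant values of \<open>- c\<close> below any bound;
      \<open>r\<close> counts the repetitions.\<close>
    have "?S = \<infinity>"
    proof (rule ereal_top)
      fix B :: real
      obtain r :: nat where r: "(B + t) / (- s) \<le> real r" using real_arch_simple by blast
      have "real r * s + t \<in> majorant_values (\<lambda>x. - c x)"
        using majorant_values_add[OF majorant_values_scale[OF s(1), of "real r"] t] by simp
      then have "ereal (- (real r * s + t)) \<le> ?S" by (rule SUP_upper)
      moreover have "B \<le> - (real r * s + t)" using r s(2) by (simp add: field_simps)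
      ultimately show "ereal B \<le> ?S" by (meson ereal_less_eq(3) order_trans)
    qed
    then show ?thesis by simp
  next
    case False
    then have nonneg: "\<And>s. s \<in> majorant_values (\<lambda>x. 0) \<Longrightarrow> 0 \<le> s" by force
    have vs: "vector_space (\<lambda>(r::real) (h::(nat \<Rightarrow> 'a) \<Rightarrow> real) x. r * h x)"
      by unfold_locales (auto simp: fun_eq_iff algebra_simps)
    obtain L where L: "\<And>g h. g \<in> CL n X \<mu> \<Longrightarrow> h \<in> CL n X \<mu> \<Longrightarrow> L (g + h) = L g + L h"
      "\<And>r h. h \<in> CL n X \<mu> \<Longrightarrow> L (\<lambda>x. r * h x) = r * L h"
      "\<And>h. h \<in> CL n X \<mu> \<Longrightarrow> L h \<le> upper_price h" "L (\<lambda>x. - c x) = upper_price (\<lambda>x. - c x)"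
      by (rule hahn_banach_dominated[OF vs CL_subspace upper_price_sublinear(1)[OF nonneg] nc]) (assumption, rule that)
    obtain \<pi> where \<pi>: "\<pi> \<in> couplings_on n X \<mu> W" "\<And>h. h \<in> CL n X \<mu> \<Longrightarrow> (\<integral>x. h x \<partial>\<pi>) = L h"
    proof (rule coupling_of_functional[of L])
      show "L (\<lambda>x. g x + h x) = L g + L h" if "g \<in> CL n X \<mu>" "h \<in> CL n X \<mu>" for g h
        using L(1)[OF that] by (simp add: plus_fun_def)
      show "L h \<le> s" if "h \<in> CL n X \<mu>" "s \<in> majorant_values h" for h s
        using L(3)[OF that(1)] upper_price_sublinear(2)[OF nonneg that] by simp
    qed (use L(2) that in auto)
    have "?I \<le> ereal (\<integral>x. c x \<partial>\<pi>)" by (rule INF_lower[OF \<pi>(1)])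
    also have "(\<integral>x. c x \<partial>\<pi>) = - upper_price (\<lambda>x. - c x)"
      using \<pi>(2)[OF c] \<pi>(2)[OF nc] L(4) by simp
    \<comment> \<open>The supremum is minus an infimum that need not be attained, hence the room
      \<open>e\<close>.\<close>
    also have "ereal \<dots> \<le> ?S"
    proof (rule ereal_le_epsilon2)
      fix e :: real assume e: "0 < e"
      have "\<exists>s\<in>majorant_values (\<lambda>x. - c x). s < upper_price (\<lambda>x. - c x) + e"
        unfolding upper_price_def
        using majorant_values_nonempty[OF nc] e by (intro cInf_lessD) auto
      then obtain s where s: "s \<in> majorant_values (\<lambda>x. - c x)" "s < upper_price (\<lambda>x. - c x) + e" by blast
      have "ereal (- upper_price (\<lambda>x. - c x)) \<le> ereal (- s) + ereal e" using s(2) by simp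
      also have "\<dots> \<le> ?S + ereal e" by (intro add_right_mono SUP_upper s(1))
      finally show "ereal (- upper_price (\<lambda>x. - c x)) \<le> ?S + ereal e" .
    qed
    finally show ?thesis .
  qed
qed

end

text \<open>Both sides are taken in \<open>ereal\<close>, where the infimum over an empty set of
  couplings is \<open>\<infinity>\<close>, as the convention demands.\<close>

theorem theorem2p1:
  fixes n :: nat
    and X :: "nat \<Rightarrow> 'a topology"
    and \<mu> :: "nat \<Rightarrow> 'a measure"
    and W :: "((nat \<Rightarrow> 'a) \<Rightarrow> real) set"
    and c :: "(nat \<Rightarrow> 'a) \<Rightarrow> real"
  assumes "n \<ge> 1"
    and "\<And>k. k \<in> {1..n} \<Longrightarrow> polish_topology (X k)"
    and "\<And>k. k \<in> {1..n} \<Longrightarrow> borel_prob (X k) (\<mu> k)"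
    and "fun_subspace W" and "W \<subseteq> CL n X \<mu>"
    and "c \<in> CL n X \<mu>"
  shows "(INF \<pi>\<in>couplings_on n X \<mu> W. ereal (\<integral>x. c x \<partial>\<pi>)) =
    Sup {ereal (\<Sum>k=1..n. \<integral>x. f k x \<partial>\<mu> k) | f \<omega>.
          (\<forall>k\<in>{1..n}. f k \<in> CL1 (X k) (\<mu> k)) \<and> \<omega> \<in> W \<and>
          (\<forall>x\<in>topspace (prod_top n X). (\<Sum>k=1..n. f k (x k)) + \<omega> x \<le> c x)}"
proof -
  interpret constrained_marginals n X \<mu> W
    by unfold_locales (fact assms)+
  show ?thesis unfolding dual_set_eq by (rule duality[OF assms(6)])
qed

end
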